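(* For all $c>0$, all integers $p\ge-1$, and all non-negative integers $N,k$, $$\beta_{N,k}=c^{-\frac{p+1}{2}}\,\frac{\lim_{r\to0^+} r^{-N-\frac{p+1}{2}}M_{N,c}[\varphi_{N,k}](r)}{\tilde\varphi_{N,k}(0)}=\frac{a_{k,0}\,c^N\left(2^{N+p/2}\,\Gamma(N+p/2+1)\,\sqrt{2N+p+2}\right)^{-1}}{\sum_{i=0}^\infty a_{k,i}\sqrt{2(2i+N+p/2+1)}\,(-1)^i\binom{i+N+p/2}{i}}.$$
   Context: Let $p\ge-1$ be an integer, $c>0$, and let $J_\nu$ be the Bessel function of the first kind. For a non-negative integer $N$ define the compact self-adjoint operator $H_{N,c}$ on $L^2([0,1],\rho^{p+1}d\rho)$ by $$H_{N,c}[\Phi](r)=\int_0^1 \frac{J_{N+p/2}(cr\rho)}{(cr\rho)^{p/2}}\,\Phi(\rho)\,\rho^{p+1}\,d\rho,\qquad 0\le r\le 1$$ (kernel extended by continuity where $r\rho=0$). Its eigenvalues are $\beta_{N,0},\beta_{N,1},\ldots$ with $|\beta_{N,n}|\ge|\beta_{N,n+1}|$ (they are nonzero), and $\Phi_{N,n}$ is the real-valued eigenfunction for $\beta_{N,n}$, normalized by $\int_0^1\Phi_{N,n}(r)^2r^{p+1}dr=1$ and $\Phi_{N,n}(1)>0$. Put $\varphi_{N,n}(r)=r^{(p+1)/2}\Phi_{N,n}(r)$ and $\tilde\varphi_{N,n}(r)=\varphi_{N,n}(r)/r^{N+\frac{p+1}{2}}$, with $\tilde\varphi_{N,n}(0)$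 the limit as $r\to0^+$. Let $$M_{N,c}[\varphi](r)=\int_0^1J_{N+p/2}(cr\rho)\sqrt{cr\rho}\,\varphi(\rho)\,d\rho .$$ The radial Zernike polynomials are $R_{N,i}(r)=r^N\sum_{m=0}^i(-1)^m\binom{i+N+\frac p2}{m}\binom{i}{m}(r^2)^{i-m}(1-r^2)^m$, with normalization $\overline R_{N,i}(r)=\sqrt{2(2i+N+p/2+1)}\,R_{N,i}(r)$. For fixed $N$, $a_{k,i}=\int_0^1\overline R_{N,i}(r)\,\Phi_{N,k}(r)\,r^{p+1}\,dr$ is the $i$th coefficient of $\Phi_{N,k}$ in its expansion $\Phi_{N,k}=\sum_i a_{k,i}\overline R_{N,i}$. *)

theory Defs
  imports "HOL-Analysis.Analysis"
begin

text \<open>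
  Intended for real \<open>x \<ge> 0\<close>. The prefactor is \<open>(x/2)\<^sup>\<nu>\<close>; the case distinction is needed because
  \<open>0 powr 0 = 0\<close>, whereas \<open>J\<^sub>0(0) = 1\<close>. The reciprocal Gamma function makes the series
  meaningful for every real order.
\<close>
definition bessel_J :: "real \<Rightarrow> real \<Rightarrow> real" where
  "bessel_J \<nu> x = (if \<nu> = 0 then 1 else (x / 2) powr \<nu>) *
     (\<Sum>m. (-1) ^ m * rGamma (\<nu> + real m + 1) / fact m * (x / 2) ^ (2 * m))"

text \<open>
  The measure \<open>\<rho>\<^bsup>p+1\<^esup> d\<rho>\<close> on \<open>[0,1]\<close>. The exponent is a non-negative integer for \<open>p \<ge> -1\<close>, and
  \<open>0 powi 0 = 1\<close>.
\<close>
definition radial_measure :: "int \<Rightarrow> real measure" where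
  "radial_measure p = density (lebesgue_on {0..1}) (\<lambda>\<rho>. ennreal (\<rho> powi (p + 1)))"

definition radial_L2 :: "int \<Rightarrow> (real \<Rightarrow> real) set" where
  "radial_L2 p = {f. f \<in> borel_measurable (radial_measure p) \<and>
     integrable (radial_measure p) (\<lambda>\<rho>. (f \<rho>)\<^sup>2)}"

text \<open>The function \<open>t \<mapsto> J\<^bsub>N+p/2\<^esub>(t) / t\<^bsup>p/2\<^esup>\<close>, extended by continuity to \<open>t = 0\<close>.\<close>
definition H_kernel :: "int \<Rightarrow> nat \<Rightarrow> real \<Rightarrow> real" where
  "H_kernel p N t =
     (let k = (\<lambda>s. bessel_J (real N + of_int p / 2) s / s powr (of_int p / 2))
      in if t = 0 then Lim (at_right 0) k else k t)"

definition H_op :: "int \<Rightarrow> real \<Rightarrow> nat \<Rightarrow> (real \<Rightarrow> real) \<Rightarrow> real \<Rightarrow> real" where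
  "H_op p c N \<Phi> r = (\<integral>\<rho>. H_kernel p N (c * r * \<rho>) * \<Phi> \<rho> \<partial>radial_measure p)"

definition M_op :: "int \<Rightarrow> real \<Rightarrow> nat \<Rightarrow> (real \<Rightarrow> real) \<Rightarrow> real \<Rightarrow> real" where
  "M_op p c N \<phi> r =
     (\<integral>\<rho>. bessel_J (real N + of_int p / 2) (c * r * \<rho>) * sqrt (c * r * \<rho>) * \<phi> \<rho>
        \<partial>lebesgue_on {0..1})"

text \<open>
  Eigenvalues of \<open>H_op\<close> as an operator on equivalence classes of square-integrable functions.
  The kernel is real and symmetric, so real scalars yield the same eigenvalues as complex ones.
\<close>
definition H_eigenvalue :: "int \<Rightarrow> real \<Rightarrow> nat \<Rightarrow> real \<Rightarrow> bool" where
  "H_eigenvalue p c N \<mu> \<longleftrightarrow>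
     (\<exists>f \<in> radial_L2 p. \<not> (AE r in radial_measure p. f r = 0) \<and>
        (AE r in radial_measure p. H_op p c N f r = \<mu> * f r))"

text \<open>
  \<open>\<beta>\<close> lists each eigenvalue once (the eigenvalues are simple, which is not assumed here).
  The eigenvalue equation for \<open>\<Phi> n\<close> is required at every point of \<open>[0,1]\<close>: this selects the
  continuous representative of the \<open>L\<^sup>2\<close> class, so that the values \<open>\<Phi> n 1\<close> and the limits at \<open>0\<close>
  make sense.
\<close>
definition H_eigensystem ::
    "int \<Rightarrow> real \<Rightarrow> nat \<Rightarrow> (nat \<Rightarrow> real) \<Rightarrow> (nat \<Rightarrow> real \<Rightarrow> real) \<Rightarrow> bool" where
  "H_eigensystem p c N \<beta> \<Phi> \<longleftrightarrow>
     inj \<beta> \<and> range \<beta> = {\<mu>. H_eigenvalue p c N \<mu>} \<and>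
     (\<forall>n. \<beta> n \<noteq> 0) \<and> (\<forall>n. \<bar>\<beta> n\<bar> \<ge> \<bar>\<beta> (Suc n)\<bar>) \<and>
     (\<forall>n. \<Phi> n \<in> radial_L2 p \<and>
          (\<forall>r\<in>{0..1}. H_op p c N (\<Phi> n) r = \<beta> n * \<Phi> n r) \<and>
          (\<integral>r. (\<Phi> n r)\<^sup>2 \<partial>radial_measure p) = 1 \<and>
          \<Phi> n 1 > 0)"

text \<open>
  \<open>\<phi>(r) = r\<^bsup>(p+1)/2\<^esup> \<Phi>(r)\<close>; for \<open>r \<ge> 0\<close> the power is written as an integer power of \<open>sqrt r\<close>,
  which is correct at \<open>r = 0\<close>, \<open>p = -1\<close> too.
\<close>
definition phi_of :: "int \<Rightarrow> (real \<Rightarrow> real) \<Rightarrow> real \<Rightarrow> real" where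
  "phi_of p \<Phi> r = sqrt r powi (p + 1) * \<Phi> r"

definition phi_tilde :: "int \<Rightarrow> nat \<Rightarrow> (real \<Rightarrow> real) \<Rightarrow> real \<Rightarrow> real" where
  "phi_tilde p N \<Phi> r =
     (let q = (\<lambda>s. phi_of p \<Phi> s / s powr (real N + (of_int p + 1) / 2))
      in if r = 0 then Lim (at_right 0) q else q r)"

definition zernike_R :: "int \<Rightarrow> nat \<Rightarrow> nat \<Rightarrow> real \<Rightarrow> real" where
  "zernike_R p N i r = r ^ N *
     (\<Sum>m=0..i. (-1) ^ m * ((real i + real N + of_int p / 2) gchoose m) * real (i choose m) *
        (r\<^sup>2) ^ (i - m) * (1 - r\<^sup>2) ^ m)"

definition zernike_Rbar :: "int \<Rightarrow> nat \<Rightarrow> nat \<Rightarrow> real \<Rightarrow> real" where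
  "zernike_Rbar p N i r =
     sqrt (2 * (2 * real i + real N + of_int p / 2 + 1)) * zernike_R p N i r"

definition zernike_coeff :: "int \<Rightarrow> nat \<Rightarrow> (real \<Rightarrow> real) \<Rightarrow> nat \<Rightarrow> real" where
  "zernike_coeff p N \<Phi> i = (\<integral>r. zernike_Rbar p N i r * \<Phi> r \<partial>radial_measure p)"

end

theory Submission imports Defs begin

text \<open>
  An eigenfunction \<open>\<Phi>\<close> with eigenvalue \<open>\<beta> \<noteq> 0\<close> lies in the range of the operator, so by the Bessel
  series it is \<open>\<Phi>(r) = r\<^sup>N G(r\<^sup>2)\<close> with \<open>G(x) = \<Sum>g\<^sub>l x\<^sup>l\<close> entire. Both formulas for \<open>\<beta>\<close> are the
  eigenvalue equation divided by \<open>r\<^sup>N\<close> in the limit \<open>r \<rightarrow> 0\<close>, where the right side becomes \<open>\<beta> g\<^sub>0\<close>.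
  The first formula keeps the left side as a limit, rewritten through \<open>M\<close> (\<open>M_op_eq_H_op\<close>). For the
  second, the left side is the leading coefficient of the kernel times the zeroth moment of \<open>\<Phi>\<close>, a
  multiple of the zeroth Zernike coefficient (\<open>eigenvalue_times_head\<close>), and \<open>g\<^sub>0\<close> is the value at the
  origin of the Zernike expansion of \<open>\<Phi>(r) / r\<^sup>N\<close> (\<open>zernike_expansion_at_0\<close>). Two points need an argument.

  The first is \<open>g\<^sub>0 \<noteq> 0\<close> (\<open>eigvec_head_nonzero\<close>). The generalized prolate spheroidal differential
  operator \<open>L\<close> commutes with the integral operator (\<open>eigvec_spheroidal\<close>), and a solution of \<open>L G = \<gamma> G\<close>
  that is analytic at \<open>0\<close> is determined by \<open>G(0)\<close>. It remains to see that \<open>G\<close> is an eigenfunction of \<open>L\<close>,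
  which would be immediate if \<open>\<beta>\<close> were known to be simple. The generator \<open>S\<close> of dilations is skew up to
  the boundary term at \<open>1\<close> and anticommutes with the integral operator on functions vanishing at \<open>1\<close>.
  Consequently \<open>S\<close> carries an eigenfunction for \<open>\<beta>\<close> that vanishes at \<open>1\<close> to one for \<open>-\<beta>\<close>
  (\<open>eigvec_dilation\<close>), while eigenfunctions \<open>F\<close> for \<open>-\<beta>\<close> and \<open>G\<close> for \<open>\<beta>\<close> satisfy \<open>F(1) G(1) = 0\<close>
  (\<open>eigvec_opposite\<close>). Every eigenvalue has an eigenfunction that is positive at \<open>1\<close>, so \<open>\<beta>\<close> and \<open>-\<beta>\<close>
  are not both eigenvalues, and no nonzero eigenfunction for \<open>\<beta>\<close> vanishes at \<open>1\<close>. This applies to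
  \<open>L G - \<gamma> G\<close> with \<open>\<gamma> = (L G)(1) / G(1)\<close>.

  The second is convergence of the Zernike expansion at the single point \<open>0\<close>. For a monomial \<open>x\<^sup>l\<close> the
  partial sums at the origin have a closed form (\<open>zernike_telescope\<close>), bounded by \<open>2\<^sup>l\<close> and
  eventually equal to the value of \<open>x\<^sup>l\<close> at \<open>0\<close>; dominated convergence against the rapidly decreasing
  \<open>g\<^sub>l\<close> does the rest.

  The integral operator is treated throughout as an infinite matrix acting on the Taylor coefficients
  of \<open>G\<close>, which replaces differentiation under the integral and integration by parts by rational
  identities.
\<close>

section \<open>Coefficients of entire functions\<close>

text \<open>
  Coefficient sequences of entire functions: absolute convergence of \<open>\<Sum>g\<^sub>m R\<^sup>m\<close> for every radius
  leaves room for polynomial factors in \<open>m\<close> and for index shifts, so all rearrangements below are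
  licensed by this single property.
\<close>
definition entire_coeffs :: "(nat \<Rightarrow> real) \<Rightarrow> bool" where
  "entire_coeffs g \<longleftrightarrow> (\<forall>R. summable (\<lambda>m. \<bar>g m\<bar> * R ^ m))"

lemma entire_coeffsI:
  assumes "\<And>m. \<bar>g m\<bar> \<le> C * B ^ m / fact m"
  shows "entire_coeffs g"
  unfolding entire_coeffs_def
proof
  fix R :: real
  have "summable (\<lambda>m. C * (inverse (fact m) * (B * \<bar>R\<bar>) ^ m))"
    by (intro summable_mult summable_exp)
  then show "summable (\<lambda>m. \<bar>g m\<bar> * R ^ m)"
  proof (rule summable_comparison_test'[where N = 0])
    fix m :: nat
    have "norm (\<bar>g m\<bar> * R ^ m) = \<bar>g m\<bar> * \<bar>R\<bar> ^ m"
      by (simp add: abs_mult power_abs)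
    also have "\<dots> \<le> C * B ^ m / fact m * \<bar>R\<bar> ^ m"
      by (intro mult_right_mono assms) auto
    finally show "norm (\<bar>g m\<bar> * R ^ m) \<le> C * (inverse (fact m) * (B * \<bar>R\<bar>) ^ m)"
      by (simp add: field_simps)
  qed
qed

lemma entire_coeffs_summable: "entire_coeffs g \<Longrightarrow> summable (\<lambda>m. \<bar>g m\<bar> * R ^ m)"
  by (simp add: entire_coeffs_def)

lemma entire_coeffs_summable_abs: "entire_coeffs g \<Longrightarrow> summable (\<lambda>m. \<bar>g m\<bar>)"
  using entire_coeffs_summable[of g 1] by simp

lemma entire_coeffs_times_index:
  assumes "entire_coeffs g"
  shows "entire_coeffs (\<lambda>m. real m * g m)"
  unfolding entire_coeffs_def
proof
  fix R :: real
  from assms have "summable (\<lambda>m. \<bar>g m\<bar> * (2 * \<bar>R\<bar>) ^ m)"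
    by (rule entire_coeffs_summable)
  then show "summable (\<lambda>m. \<bar>real m * g m\<bar> * R ^ m)"
  proof (rule summable_comparison_test'[where N = 0])
    fix m :: nat
    have "real m \<le> 2 ^ m"
      by (metis less_exp less_imp_le of_nat_le_iff of_nat_numeral of_nat_power)
    then have "real m * (\<bar>g m\<bar> * \<bar>R\<bar> ^ m) \<le> 2 ^ m * (\<bar>g m\<bar> * \<bar>R\<bar> ^ m)"
      by (intro mult_right_mono) auto
    then show "norm (\<bar>real m * g m\<bar> * R ^ m) \<le> \<bar>g m\<bar> * (2 * \<bar>R\<bar>) ^ m"
      by (simp add: abs_mult power_abs power_mult_distrib mult_ac)
  qed
qed

lemma entire_coeffs_cmult: "entire_coeffs g \<Longrightarrow> entire_coeffs (\<lambda>m. b * g m)"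
  by (simp add: entire_coeffs_def abs_mult mult.assoc summable_mult)

lemma entire_coeffs_add:
  assumes "entire_coeffs f" "entire_coeffs g"
  shows "entire_coeffs (\<lambda>m. f m + g m)"
  unfolding entire_coeffs_def
proof
  fix R :: real
  have "summable (\<lambda>m. \<bar>f m\<bar> * \<bar>R\<bar> ^ m + \<bar>g m\<bar> * \<bar>R\<bar> ^ m)"
    using assms by (intro summable_add entire_coeffs_summable)
  then show "summable (\<lambda>m. \<bar>f m + g m\<bar> * R ^ m)"
    by (rule summable_comparison_test'[where N = 0])
       (auto simp: abs_mult power_abs simp flip: distrib_right intro!: mult_right_mono)
qed

lemma entire_coeffs_shift_down:
  assumes "entire_coeffs g"
  shows "entire_coeffs (\<lambda>m. g (Suc m))"
  unfolding entire_coeffs_def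
proof
  fix R :: real
  let ?Q = "\<bar>R\<bar> + 1"
  have "summable (\<lambda>m. \<bar>g (Suc m)\<bar> * ?Q ^ Suc m)"
    using entire_coeffs_summable[OF assms, of ?Q] by (subst summable_Suc_iff)
  then show "summable (\<lambda>m. \<bar>g (Suc m)\<bar> * R ^ m)"
  proof (rule summable_comparison_test'[where N = 0])
    fix m :: nat
    have "\<bar>R\<bar> ^ m \<le> ?Q ^ m" by (intro power_mono) auto
    also have "\<dots> \<le> ?Q ^ Suc m" by (intro power_increasing) auto
    finally show "norm (\<bar>g (Suc m)\<bar> * R ^ m) \<le> \<bar>g (Suc m)\<bar> * ?Q ^ Suc m"
      by (simp add: abs_mult power_abs mult_left_mono del: power_Suc)
  qed
qed

lemma entire_coeffs_shift_up:
  assumes "entire_coeffs g"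
  shows "entire_coeffs (\<lambda>m. if m = 0 then 0 else g (m - 1))"
  unfolding entire_coeffs_def
proof
  fix R :: real
  have "summable (\<lambda>m. \<bar>g m\<bar> * R ^ m * R)"
    by (intro summable_mult2 entire_coeffs_summable assms)
  then show "summable (\<lambda>m. \<bar>if m = 0 then 0 else g (m - 1)\<bar> * R ^ m)"
    by (subst summable_Suc_iff[symmetric]) (simp add: mult_ac)
qed

section \<open>Eigenvectors of scaled Hilbert matrices\<close>

text \<open>
  With \<open>x = r\<^sup>2\<close>, the finite Hankel transform acts on Taylor coefficients through the matrix
  \<open>a\<^sub>m / (m + l + \<nu> + 1)\<close>: the entries \<open>1 / (m + l + \<nu> + 1) = \<integral> x\<^bsup>m+l\<^esup> x\<^sup>\<nu> dx\<close> form the Gram matrix of the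
  monomials on \<open>[0,1]\<close>, and \<open>a\<^sub>m\<close> are the Taylor coefficients of the kernel up to a constant factor. The recurrence of \<open>a\<close> is
  Bessel's differential equation. Integration by parts on \<open>[0,1]\<close> becomes an identity between rational
  functions of \<open>m\<close> and \<open>l\<close>.
\<close>
locale scaled_Hilbert_matrix =
  fixes \<nu> \<kappa> :: real and a :: "nat \<Rightarrow> real"
  assumes nu_gt: "\<nu> > -1" and kappa_pos: "\<kappa> > 0" and a0: "a 0 \<noteq> 0"
    and a_Suc: "\<And>m. (real m + 1) * (real m + \<nu> + 1) * a (Suc m) = - \<kappa> * a m"
begin

definition moment :: "(nat \<Rightarrow> real) \<Rightarrow> nat \<Rightarrow> real" where
  "moment g m = (\<Sum>l. g l / (real m + real l + \<nu> + 1))"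

definition eigvec :: "real \<Rightarrow> (nat \<Rightarrow> real) \<Rightarrow> bool" where
  "eigvec \<beta> g \<longleftrightarrow> summable (\<lambda>m. \<bar>g m\<bar>) \<and> (\<forall>m. \<beta> * g m = a m * moment g m)"

lemma denom_pos: "real m + \<nu> + 1 > 0"
  using nu_gt by linarith

lemma denom2_pos: "real m + real l + \<nu> + 1 > 0"
  using nu_gt by linarith

lemma a_nonzero: "a m \<noteq> 0"
proof (induction m)
  case (Suc m)
  then have "- \<kappa> * a m \<noteq> 0" using kappa_pos by simp
  then show ?case by (metis a_Suc mult_zero_right)
qed (rule a0)

lemma a_bound: "\<bar>a m\<bar> \<le> \<bar>a 0\<bar> * (\<kappa> / (\<nu> + 1)) ^ m / fact m"
proof (induction m)
  case (Suc m)
  have d: "(real m + 1) * (\<nu> + 1) > 0"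
    using nu_gt by (intro mult_pos_pos) auto
  have "(real m + 1) * (\<nu> + 1) * \<bar>a (Suc m)\<bar> \<le> (real m + 1) * (real m + \<nu> + 1) * \<bar>a (Suc m)\<bar>"
    by (intro mult_right_mono mult_left_mono) auto
  also have "\<dots> = \<bar>(real m + 1) * (real m + \<nu> + 1) * a (Suc m)\<bar>"
    using denom_pos[of m] by (simp add: abs_mult)
  also have "\<dots> = \<kappa> * \<bar>a m\<bar>"
    using kappa_pos by (subst a_Suc) (simp add: abs_mult)
  finally have "\<bar>a (Suc m)\<bar> \<le> \<kappa> * \<bar>a m\<bar> / ((real m + 1) * (\<nu> + 1))"
    by (subst pos_le_divide_eq[OF d]) (simp only: mult_ac)
  also have "\<dots> \<le> \<kappa> * (\<bar>a 0\<bar> * (\<kappa> / (\<nu> + 1)) ^ m / fact m) / ((real m + 1) * (\<nu> + 1))"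
    using Suc kappa_pos d by (intro divide_right_mono mult_left_mono) auto
  also have "\<dots> = \<bar>a 0\<bar> * (\<kappa> / (\<nu> + 1)) ^ Suc m / fact (Suc m)"
    using nu_gt by (simp add: field_simps)
  finally show ?case .
qed simp

lemma summable_moment:
  assumes "summable (\<lambda>m. \<bar>g m\<bar>)"
  shows "summable (\<lambda>l. g l / (real m + real l + \<nu> + 1))"
    and "\<bar>moment g m\<bar> \<le> (\<Sum>l. \<bar>g l\<bar>) / (\<nu> + 1)"
proof -
  have le: "\<bar>g l / (real m + real l + \<nu> + 1)\<bar> \<le> \<bar>g l\<bar> / (\<nu> + 1)" for l
    using nu_gt denom2_pos[of m l] by (auto simp: abs_divide intro!: divide_left_mono)
  have s: "summable (\<lambda>l. \<bar>g l\<bar> / (\<nu> + 1))"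
    using assms by (rule summable_divide)
  have t: "summable (\<lambda>l. \<bar>g l / (real m + real l + \<nu> + 1)\<bar>)"
    by (rule summable_comparison_test'[OF s, where N = 0]) (use le in auto)
  then show "summable (\<lambda>l. g l / (real m + real l + \<nu> + 1))"
    by (rule summable_rabs_cancel)
  have "\<bar>moment g m\<bar> \<le> (\<Sum>l. \<bar>g l / (real m + real l + \<nu> + 1)\<bar>)"
    unfolding moment_def by (rule summable_rabs[OF t])
  also have "\<dots> \<le> (\<Sum>l. \<bar>g l\<bar> / (\<nu> + 1))"
    by (intro suminf_le le t s)
  also have "\<dots> = (\<Sum>l. \<bar>g l\<bar>) / (\<nu> + 1)"
    using assms by (rule suminf_divide)
  finally show "\<bar>moment g m\<bar> \<le> (\<Sum>l. \<bar>g l\<bar>) / (\<nu> + 1)" .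
qed

text \<open>
  The moments are bounded, so an eigenvector decays as fast as \<open>a\<close>, that is, like the
  coefficients of an exponential. Absolute summability thus upgrades itself.
\<close>
lemma eigvec_entire:
  assumes "eigvec \<beta> g" "\<beta> \<noteq> 0"
  shows "entire_coeffs g"
proof (rule entire_coeffsI)
  fix m
  define K where "K = (\<Sum>l. \<bar>g l\<bar>) / (\<nu> + 1)"
  have g: "summable (\<lambda>m. \<bar>g m\<bar>)" and eq: "\<beta> * g m = a m * moment g m"
    using assms by (auto simp: eigvec_def)
  have "\<bar>\<beta>\<bar> * \<bar>g m\<bar> = \<bar>a m\<bar> * \<bar>moment g m\<bar>"
    by (metis abs_mult eq)
  also have "\<dots> \<le> \<bar>a 0\<bar> * (\<kappa> / (\<nu> + 1)) ^ m / fact m * K"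
    unfolding K_def using kappa_pos nu_gt
    by (intro mult_mono a_bound summable_moment g) auto
  finally have "\<bar>g m\<bar> \<le> (\<bar>a 0\<bar> * (\<kappa> / (\<nu> + 1)) ^ m / fact m * K) / \<bar>\<beta>\<bar>"
    using assms(2) by (subst pos_le_divide_eq) (simp_all add: mult.commute)
  then show "\<bar>g m\<bar> \<le> (\<bar>a 0\<bar> * K / \<bar>\<beta>\<bar>) * (\<kappa> / (\<nu> + 1)) ^ m / fact m"
    by (simp add: mult_ac)
qed

text \<open>
  The coefficients of \<open>x G'(x) + (\<nu> + 1)/2 G(x)\<close>: the generator of dilations, normalized so as to
  be skew with respect to \<open>\<integral>\<^sub>0\<^sup>1 F G x\<^sup>\<nu> dx\<close> up to the boundary term \<open>F(1) G(1)\<close>.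
\<close>
definition dilation :: "(nat \<Rightarrow> real) \<Rightarrow> nat \<Rightarrow> real" where
  "dilation g m = (real m + (\<nu> + 1) / 2) * g m"

lemma entire_dilation: "entire_coeffs g \<Longrightarrow> entire_coeffs (dilation g)"
  using entire_coeffs_add[OF entire_coeffs_times_index entire_coeffs_cmult, of g g "(\<nu> + 1) / 2"]
  by (simp add: dilation_def[abs_def] distrib_right)

text \<open>
  Integration by parts against \<open>x\<^sup>m\<close>; the term \<open>\<Sum>l. g l\<close> is the boundary value of the power series
  at \<open>1\<close>.
\<close>
lemma moment_dilation:
  assumes "entire_coeffs g"
  shows "moment (dilation g) m = (\<Sum>l. g l) - (real m + (\<nu> + 1) / 2) * moment g m"
proof -
  let ?s = "real m + (\<nu> + 1) / 2"
  have g: "summable g" "summable (\<lambda>m. \<bar>g m\<bar>)"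
    using entire_coeffs_summable_abs[OF assms] summable_rabs_cancel by blast+
  have "dilation g l / (real m + real l + \<nu> + 1) = g l - ?s * (g l / (real m + real l + \<nu> + 1))" for l
    using denom2_pos[of m l] by (simp add: dilation_def field_simps)
  then have "moment (dilation g) m = (\<Sum>l. g l - ?s * (g l / (real m + real l + \<nu> + 1)))"
    by (simp add: moment_def)
  also have "\<dots> = (\<Sum>l. g l) - (\<Sum>l. ?s * (g l / (real m + real l + \<nu> + 1)))"
    by (intro suminf_diff[symmetric] g summable_mult summable_moment)
  also have "\<dots> = (\<Sum>l. g l) - ?s * moment g m"
    unfolding moment_def by (subst suminf_mult) (auto intro!: g summable_moment)
  finally show ?thesis .
qed

text \<open>
  The kernel depends on \<open>x y\<close> only, so it does not distinguish a dilation in \<open>x\<close> from one in \<open>y\<close>;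
  moving the dilation across the integral changes its sign. Hence dilation anticommutes with the
  operator as soon as the boundary value vanishes.
\<close>
lemma eigvec_dilation:
  assumes "eigvec \<beta> g" "\<beta> \<noteq> 0" "(\<Sum>l. g l) = 0"
  shows "eigvec (- \<beta>) (dilation g)"
proof -
  note e = eigvec_entire[OF assms(1,2)]
  have "- \<beta> * dilation g m = a m * moment (dilation g) m" for m
  proof -
    have "moment (dilation g) m = - (real m + (\<nu> + 1) / 2) * moment g m"
      unfolding moment_dilation[OF e] assms(3) by (simp only: diff_0 mult_minus_left)
    then have "a m * moment (dilation g) m = - (real m + (\<nu> + 1) / 2) * (a m * moment g m)"
      by (simp only: mult_ac)
    also have "\<dots> = - (real m + (\<nu> + 1) / 2) * (\<beta> * g m)"
      using assms(1) by (simp add: eigvec_def)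
    finally show ?thesis unfolding dilation_def by (simp only: mult_minus_left mult_minus_right mult_ac)
  qed
  then show ?thesis
    using entire_coeffs_summable_abs[OF entire_dilation[OF e]] by (simp add: eigvec_def)
qed

text \<open>
  Both sides are the bilinear form \<open>\<integral> F G x\<^sup>\<nu> dx\<close> written as a double series.
\<close>
lemma moment_symmetric:
  assumes f: "summable (\<lambda>m. \<bar>f m\<bar>)" and g: "summable (\<lambda>m. \<bar>g m\<bar>)"
  shows "summable (\<lambda>m. f m * moment g m)"
    and "(\<Sum>m. f m * moment g m) = (\<Sum>l. g l * moment f l)"
proof -
  have abs_sum: "summable (\<lambda>m. \<bar>f m * moment g m\<bar>)"
    if f: "summable (\<lambda>m. \<bar>f m\<bar>)" and g: "summable (\<lambda>m. \<bar>g m\<bar>)" for f g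
  proof (rule summable_comparison_test'[where N = 0])
    show "summable (\<lambda>m. \<bar>f m\<bar> * ((\<Sum>l. \<bar>g l\<bar>) / (\<nu> + 1)))"
      using f by (rule summable_mult2)
    show "norm \<bar>f m * moment g m\<bar> \<le> \<bar>f m\<bar> * ((\<Sum>l. \<bar>g l\<bar>) / (\<nu> + 1))" for m
      using summable_moment(2)[OF g, of m] by (simp add: abs_mult mult_left_mono del: times_divide_eq_right)
  qed
  show "summable (\<lambda>m. f m * moment g m)"
    by (rule summable_rabs_cancel[OF abs_sum[OF f g]])
  define F where "F m l = f m * (g l / (real m + real l + \<nu> + 1))" for m l
  have inner: "(\<Sum>\<^sub>\<infinity>l. F m l) = f m * moment g m" for m
  proof -
    have "(\<lambda>l. \<bar>F m l\<bar>) = (\<lambda>l. \<bar>f m\<bar> * (\<bar>g l\<bar> / (real m + real l + \<nu> + 1)))"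
      by (simp add: F_def abs_mult abs_of_pos[OF denom2_pos])
    then have "summable (\<lambda>l. norm (F m l))"
      using summable_moment(1)[of "\<lambda>l. \<bar>g l\<bar>" m] g by (auto intro!: summable_mult simp del: times_divide_eq_right)
    then have "(\<Sum>\<^sub>\<infinity>l. F m l) = (\<Sum>l. F m l)"
      by (intro infsumI norm_summable_imp_has_sum summable_sums) (auto intro: summable_norm_cancel)
    also have "\<dots> = f m * moment g m"
      unfolding F_def moment_def using g by (intro suminf_mult summable_moment)
    finally show ?thesis .
  qed
  have inner': "(\<Sum>\<^sub>\<infinity>m. F m l) = g l * moment f l" for l
  proof -
    have eq: "F m l = g l * (f m / (real l + real m + \<nu> + 1))" for m
      by (simp add: F_def add_ac)
    have "(\<lambda>m. \<bar>F m l\<bar>) = (\<lambda>m. \<bar>g l\<bar> * (\<bar>f m\<bar> / (real l + real m + \<nu> + 1)))"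
      by (simp add: eq abs_mult abs_of_pos[OF denom2_pos])
    then have "summable (\<lambda>m. norm (F m l))"
      using summable_moment(1)[of "\<lambda>l. \<bar>f l\<bar>" l] f by (auto intro!: summable_mult simp del: times_divide_eq_right)
    then have "(\<Sum>\<^sub>\<infinity>m. F m l) = (\<Sum>m. F m l)"
      by (intro infsumI norm_summable_imp_has_sum summable_sums) (auto intro: summable_norm_cancel)
    also have "\<dots> = g l * moment f l"
      unfolding eq moment_def using f by (intro suminf_mult summable_moment)
    finally show ?thesis .
  qed
  have outer: "(\<Sum>\<^sub>\<infinity>m. f m * moment g m) = (\<Sum>m. f m * moment g m)"
    if "summable (\<lambda>m. \<bar>f m\<bar>)" "summable (\<lambda>m. \<bar>g m\<bar>)" for f g
    using abs_sum[OF that]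
    by (intro infsumI norm_summable_imp_has_sum summable_sums) (auto intro: summable_rabs_cancel)
  have prod: "(\<lambda>(m, l). F m l) summable_on UNIV \<times> UNIV"
  proof -
    define u v where "u m = \<bar>f m\<bar> / (\<nu> + 1)" and "v m = \<bar>g m\<bar>" for m
    have uv: "u m \<ge> 0" "v m \<ge> 0" for m
      using nu_gt by (auto simp: u_def v_def)
    have 1: "u summable_on UNIV" "v summable_on UNIV"
      using f g unfolding u_def[abs_def] v_def[abs_def]
      by (auto intro!: norm_summable_imp_summable_on summable_divide simp: abs_divide)
    have "(\<lambda>x. norm (case x of (m, l) \<Rightarrow> u m * v l)) summable_on Sigma UNIV (\<lambda>_. UNIV)"
      unfolding Infinite_Sum.abs_summable_on_Sigma_iff using 1
      by (simp add: abs_mult uv infsum_cmult_right' infsum_nonneg summable_on_cmult_left summable_on_cmult_right)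
    then have "(\<lambda>x. norm (case x of (m, l) \<Rightarrow> F m l)) summable_on (UNIV \<times> UNIV)"
    proof (rule Infinite_Sum.abs_summable_on_comparison_test)
      fix x :: "nat \<times> nat"
      obtain m l where x: "x = (m, l)" by force
      have "\<bar>f m\<bar> * \<bar>g l\<bar> / (real m + real l + \<nu> + 1) \<le> \<bar>f m\<bar> * \<bar>g l\<bar> / (\<nu> + 1)"
        using nu_gt by (intro divide_left_mono) auto
      then show "norm (case x of (m, l) \<Rightarrow> F m l) \<le> norm (case x of (m, l) \<Rightarrow> u m * v l)"
        using nu_gt denom2_pos[of m l] by (simp add: x F_def u_def v_def abs_mult abs_divide)
    qed
    then show ?thesis by (rule Infinite_Sum.abs_summable_summable)
  qed
  have "(\<Sum>m. f m * moment g m) = (\<Sum>\<^sub>\<infinity>m. \<Sum>\<^sub>\<infinity>l. F m l)"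
    using outer[OF f g] by (simp add: inner)
  also have "\<dots> = (\<Sum>\<^sub>\<infinity>l. \<Sum>\<^sub>\<infinity>m. F m l)"
    by (rule infsum_swap_banach[OF prod])
  also have "\<dots> = (\<Sum>l. g l * moment f l)"
    using outer[OF g f] by (simp add: inner')
  finally show "(\<Sum>m. f m * moment g m) = (\<Sum>l. g l * moment f l)" .
qed

text \<open>
  Let \<open>S\<close> be the dilation. Since \<open>f\<close> and \<open>g\<close> have opposite eigenvalues, symmetry of the operator
  gives \<open>\<langle>f, S g\<rangle> = - \<langle>S f, g\<rangle>\<close>, whereas integration by parts gives
  \<open>\<langle>f, S g\<rangle> + \<langle>S f, g\<rangle> = f(1) g(1)\<close>.
\<close>
lemma eigvec_opposite:
  assumes "eigvec \<beta> g" "eigvec (- \<beta>) f" "\<beta> \<noteq> 0"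
  shows "(\<Sum>l. f l) * (\<Sum>l. g l) = 0"
proof -
  let ?D = "dilation"
  have e: "entire_coeffs g" "entire_coeffs f"
    using eigvec_entire assms by auto
  note s = entire_coeffs_summable_abs[OF e(1)] entire_coeffs_summable_abs[OF e(2)]
    entire_coeffs_summable_abs[OF entire_dilation[OF e(1)]]
    entire_coeffs_summable_abs[OF entire_dilation[OF e(2)]]
  have fg: "f m * moment g m = - (g m * moment f m)" for m
  proof -
    have 1: "\<beta> * g m = a m * moment g m" and 2: "- \<beta> * f m = a m * moment f m"
      using assms by (auto simp: eigvec_def)
    have "a m * (f m * moment g m) = f m * (\<beta> * g m)"
      unfolding 1 by (simp only: mult_ac)
    moreover have "a m * (g m * moment f m) = g m * (- \<beta> * f m)"
      unfolding 2 by (simp only: mult_ac)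
    ultimately have "a m * (f m * moment g m) = a m * - (g m * moment f m)"
      by (simp add: algebra_simps)
    then show ?thesis using a_nonzero[of m] mult_left_cancel by blast
  qed
  have "(\<Sum>m. f m * moment (?D g) m) = (\<Sum>m. ?D g m * moment f m)"
    by (rule moment_symmetric(2)[OF s(2,3)])
  also have "\<dots> = (\<Sum>m. - (?D f m * moment g m))"
    using fg by (intro suminf_cong) (simp add: dilation_def mult.assoc)
  also have "\<dots> = - (\<Sum>m. ?D f m * moment g m)"
    by (intro suminf_minus moment_symmetric(1) s)
  finally have 1: "(\<Sum>m. f m * moment (?D g) m) = - (\<Sum>m. ?D f m * moment g m)" .
  have "(\<Sum>m. f m * moment (?D g) m) = (\<Sum>m. f m * (\<Sum>l. g l) - ?D f m * moment g m)"
    by (intro suminf_cong) (simp add: moment_dilation[OF e(1)] dilation_def algebra_simps)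
  also have "\<dots> = (\<Sum>m. f m * (\<Sum>l. g l)) - (\<Sum>m. ?D f m * moment g m)"
    by (intro suminf_diff[symmetric] summable_mult2 moment_symmetric(1) s summable_rabs_cancel[OF s(2)])
  also have "(\<Sum>m. f m * (\<Sum>l. g l)) = (\<Sum>m. f m) * (\<Sum>l. g l)"
    by (intro suminf_mult2[symmetric] summable_rabs_cancel[OF s(2)])
  finally show ?thesis using 1 by simp
qed

text \<open>
  The coefficients of \<open>x(1-x) G'' + ((\<nu>+1) - (\<nu>+2) x) G' - \<kappa> x G\<close>, the generalized prolate
  spheroidal operator in the variable \<open>x = r\<^sup>2\<close>.
\<close>
definition spheroidal :: "(nat \<Rightarrow> real) \<Rightarrow> nat \<Rightarrow> real" where
  "spheroidal g m = (real m + 1) * (real m + \<nu> + 1) * g (Suc m)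
     - real m * (real m + \<nu> + 1) * g m - \<kappa> * (if m = 0 then 0 else g (m - 1))"

lemma entire_spheroidal:
  assumes e: "entire_coeffs g"
  shows "entire_coeffs (\<lambda>m. (real m + 1) * (real m + \<nu> + 1) * g (Suc m))"
    and "entire_coeffs (\<lambda>m. real m * (real m + \<nu> + 1) * g m)"
    and "entire_coeffs (spheroidal g)"
proof -
  have lin: "entire_coeffs (\<lambda>m. (real m + d) * h m)" if "entire_coeffs h" for d h
    using entire_coeffs_add[OF entire_coeffs_times_index entire_coeffs_cmult, OF that that, of d]
    by (simp add: distrib_right)
  show 1: "entire_coeffs (\<lambda>m. (real m + 1) * (real m + \<nu> + 1) * g (Suc m))"
    using lin[OF lin[OF entire_coeffs_shift_down[OF e], of "\<nu> + 1"], of 1] by (simp add: mult.assoc add.assoc)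
  show 2: "entire_coeffs (\<lambda>m. real m * (real m + \<nu> + 1) * g m)"
    using entire_coeffs_times_index[OF lin[OF e, of "\<nu> + 1"]] by (simp add: mult.assoc add.assoc)
  show "entire_coeffs (spheroidal g)"
    using entire_coeffs_add[OF 1 entire_coeffs_add[OF entire_coeffs_cmult[OF 2, of "-1"]
          entire_coeffs_cmult[OF entire_coeffs_shift_up[OF e], of "- \<kappa>"]]]
    by (simp add: spheroidal_def[abs_def] algebra_simps)
qed

text \<open>
  Self-adjointness: the \<open>m\<close>-th moment of the image of \<open>g\<close> equals the pairing of \<open>g\<close> with the image
  of \<open>x\<^sup>m\<close>. There is no boundary term because the leading coefficient \<open>x\<^bsup>\<nu>+1\<^esup>(1-x)\<close> vanishes at both
  ends.
\<close>
lemma moment_spheroidal: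
  assumes e: "entire_coeffs g"
  shows "moment (spheroidal g) m =
    real m * (real m + \<nu>) * moment g (m - 1) - real m * (real m + \<nu> + 1) * moment g m
      - \<kappa> * moment g (Suc m)"
proof -
  let ?d = "\<lambda>l. real m + real l + \<nu> + 1"
  note sg = entire_coeffs_summable_abs[OF e]
  have M: "(\<lambda>l. h l / (real j + real l + \<nu> + 1)) sums moment h j" if "entire_coeffs h" for h j
    unfolding moment_def using entire_coeffs_summable_abs[OF that] by (intro summable_sums summable_moment)
  define A where "A = moment (\<lambda>m. (real m + 1) * (real m + \<nu> + 1) * g (Suc m)) m"
  define B where "B = moment (\<lambda>m. real m * (real m + \<nu> + 1) * g m) m"
  define C where "C = moment (\<lambda>m. if m = 0 then 0 else g (m - 1)) m"
  have A: "(\<lambda>l. real l * (real l + \<nu>) * g l / (real m + real l + \<nu>)) sums A"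
    using M[OF entire_spheroidal(1)[OF e], of m]
    by (intro sums_Suc_imp[of "\<lambda>l. real l * (real l + \<nu>) * g l / (real m + real l + \<nu>)"])
       (simp_all add: A_def add_ac)
  have B: "(\<lambda>l. real l * (real l + \<nu> + 1) * g l / ?d l) sums B"
    using M[OF entire_spheroidal(2)[OF e], of m] by (simp add: B_def)
  have C0: "(\<lambda>l. (if l = 0 then 0 else g (l - 1)) / ?d l) sums C"
    unfolding C_def by (rule M[OF entire_coeffs_shift_up[OF e]])
  have C: "C = moment g (Suc m)"
  proof -
    have "(\<lambda>l. g l / (real (Suc m) + real l + \<nu> + 1)) sums C"
      using C0 sums_Suc_iff[of "\<lambda>l. (if l = 0 then 0 else g (l - 1)) / ?d l" C] by (simp add: add_ac)
    then show ?thesis unfolding moment_def by (simp add: sums_iff)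
  qed
  have "(\<lambda>l. (real l + 1) * (real l + \<nu> + 1) * g (Suc l) / ?d l - real l * (real l + \<nu> + 1) * g l / ?d l
          - \<kappa> * ((if l = 0 then 0 else g (l - 1)) / ?d l)) sums (A - B - \<kappa> * C)"
    using M[OF entire_spheroidal(1)[OF e], of m] M[OF entire_spheroidal(2)[OF e], of m] C0
    unfolding A_def B_def by (intro sums_diff sums_mult)
  then have "(\<lambda>l. spheroidal g l / ?d l) sums (A - B - \<kappa> * C)"
    by (simp add: spheroidal_def diff_divide_distrib)
  then have LHS: "moment (spheroidal g) m = A - B - \<kappa> * C"
    unfolding moment_def by (simp add: sums_iff)
  have "(\<lambda>l. real l * (real l + \<nu>) * g l / (real m + real l + \<nu>) - real l * (real l + \<nu> + 1) * g l / ?d l)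
      sums (A - B)"
    by (intro sums_diff A B)
  moreover have "real l * (real l + \<nu>) * g l / (real m + real l + \<nu>) - real l * (real l + \<nu> + 1) * g l / ?d l
     = real m * (real m + \<nu>) * (g l / (real (m - 1) + real l + \<nu> + 1))
       - real m * (real m + \<nu> + 1) * (g l / ?d l)" for l
  proof (cases "m = 0")
    case True
    then show ?thesis using denom_pos[of l] nu_gt
      by (cases "l = 0") (auto simp: field_simps)
  next
    case False
    then have d: "real m + real l + \<nu> > 0" using nu_gt by (cases m) auto
    have [simp]: "real (m - 1) + real l + \<nu> + 1 = real m + real l + \<nu>"
      using False by (simp add: of_nat_diff)
    \<comment> \<open>Both pairs of terms reduce to \<open>(l - m) g l\<close>, as the differences of the quadratic factors contain the denominators.\<close>
    have frac: "A / D - B * (g l / D) = E" if "A - B * g l = E * D" "D > 0" for A B D E :: real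
      using that by (simp add: diff_divide_distrib[symmetric])
    have 1: "real l * (real l + \<nu>) * g l / (real m + real l + \<nu>)
        - real m * (real m + \<nu>) * (g l / (real m + real l + \<nu>)) = (real l - real m) * g l"
      using d by (intro frac) (simp_all add: algebra_simps)
    have 2: "real l * (real l + \<nu> + 1) * g l / ?d l
        - real m * (real m + \<nu> + 1) * (g l / ?d l) = (real l - real m) * g l"
      using denom2_pos[of m l] by (intro frac) (simp_all add: algebra_simps)
    show ?thesis using 1 2 unfolding \<open>real (m - 1) + real l + \<nu> + 1 = real m + real l + \<nu>\<close> by linarith
  qed
  moreover have "(\<lambda>l. real m * (real m + \<nu>) * (g l / (real (m - 1) + real l + \<nu> + 1))
       - real m * (real m + \<nu> + 1) * (g l / ?d l)) sums
      (real m * (real m + \<nu>) * moment g (m - 1) - real m * (real m + \<nu> + 1) * moment g m)"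
    by (intro sums_diff sums_mult M e)
  ultimately have "A - B = real m * (real m + \<nu>) * moment g (m - 1) - real m * (real m + \<nu> + 1) * moment g m"
    by (simp add: sums_iff)
  then show ?thesis by (simp add: LHS C)
qed

text \<open>
  The spheroidal operator commutes with the integral operator: it is self-adjoint, and by the
  recurrence of \<open>a\<close> it acts on the kernel in the same way through either variable.
\<close>
lemma eigvec_spheroidal:
  assumes "eigvec \<beta> g" "\<beta> \<noteq> 0"
  shows "eigvec \<beta> (spheroidal g)"
proof -
  note e = eigvec_entire[OF assms]
  have eq: "\<beta> * g m = a m * moment g m" for m
    using assms by (simp add: eigvec_def)
  have "\<beta> * spheroidal g m = a m * moment (spheroidal g) m" for m
  proof -
    have up: "(real m + 1) * (real m + \<nu> + 1) * (\<beta> * g (Suc m)) = - \<kappa> * a m * moment g (Suc m)"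
      unfolding eq a_Suc[symmetric] by (simp only: mult_ac)
    have down: "\<kappa> * (if m = 0 then 0 else \<beta> * g (m - 1)) = - real m * (real m + \<nu>) * a m * moment g (m - 1)"
    proof (cases m)
      case (Suc j)
      have "real m * (real m + \<nu>) * a m = - \<kappa> * a j"
        using a_Suc[of j] by (simp add: Suc add_ac)
      then have "- real m * (real m + \<nu>) * a m = \<kappa> * a j"
        by (simp only: mult_minus_left)
      then show ?thesis by (simp add: Suc eq del: of_nat_Suc mult_minus_left)
    qed simp
    have "\<beta> * spheroidal g m = (real m + 1) * (real m + \<nu> + 1) * (\<beta> * g (Suc m))
        - real m * (real m + \<nu> + 1) * (\<beta> * g m) - \<kappa> * (if m = 0 then 0 else \<beta> * g (m - 1))"
      by (simp add: spheroidal_def algebra_simps)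
    also have "\<dots> = a m * moment (spheroidal g) m"
      unfolding up down unfolding eq moment_spheroidal[OF e] by (simp add: algebra_simps)
    finally show ?thesis .
  qed
  then show ?thesis
    using entire_coeffs_summable_abs[OF entire_spheroidal(3)[OF e]] by (simp add: eigvec_def)
qed

text \<open>
  At its regular singular point \<open>0\<close> the spheroidal equation has exponents \<open>0\<close> and \<open>-\<nu>\<close>; since
  \<open>\<nu> > -1\<close>, the three-term recurrence never degenerates, and an analytic solution is determined by its
  value at \<open>0\<close>.
\<close>
lemma spheroidal_eigvec_zero:
  assumes "\<And>m. spheroidal g m = \<gamma> * g m" "g 0 = 0"
  shows "g m = 0"
proof (induction m rule: less_induct)
  case (less m)
  show ?case
  proof (cases m)
    case (Suc j)
    have "g j = 0" "(if j = 0 then 0 else g (j - 1)) = 0"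
      using less[of j] less[of "j - 1"] by (auto simp: Suc)
    then have "(real j + 1) * (real j + \<nu> + 1) * g m = 0"
      using assms(1)[of j] by (simp add: spheroidal_def Suc)
    then show ?thesis using denom_pos[of j] by simp
  qed (use assms in simp)
qed

lemma eigvec_diff_cmult:
  assumes "eigvec \<beta> f" "eigvec \<beta> g"
  shows "eigvec \<beta> (\<lambda>m. f m - d * g m)" "(\<Sum>m. f m - d * g m) = (\<Sum>m. f m) - d * (\<Sum>m. g m)"
proof -
  have s: "summable (\<lambda>m. \<bar>f m\<bar>)" "summable (\<lambda>m. \<bar>g m\<bar>)"
    using assms by (auto simp: eigvec_def)
  note s' = s[THEN summable_rabs_cancel]
  show "(\<Sum>m. f m - d * g m) = (\<Sum>m. f m) - d * (\<Sum>m. g m)"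
    using s' by (simp add: suminf_diff[symmetric] suminf_mult summable_mult)
  have "summable (\<lambda>m. \<bar>f m - d * g m\<bar>)"
  proof (rule summable_comparison_test'[where N = 0])
    show "summable (\<lambda>m. \<bar>f m\<bar> + \<bar>d\<bar> * \<bar>g m\<bar>)"
      by (intro summable_add summable_mult s)
    show "norm \<bar>f m - d * g m\<bar> \<le> \<bar>f m\<bar> + \<bar>d\<bar> * \<bar>g m\<bar>" for m
      using abs_triangle_ineq4[of "f m" "d * g m"] by (simp add: abs_mult)
  qed
  moreover have "moment (\<lambda>m. f m - d * g m) m = moment f m - d * moment g m" for m
    unfolding moment_def using summable_moment(1)[OF s(1)] summable_moment(1)[OF s(2)]
    by (simp add: diff_divide_distrib suminf_diff[symmetric] suminf_mult[symmetric] summable_mult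
             flip: times_divide_eq_right)
  ultimately show "eigvec \<beta> (\<lambda>m. f m - d * g m)"
    using assms by (simp add: eigvec_def right_diff_distrib mult.left_commute[of _ d])
qed

text \<open>
  The hypothesis on \<open>-\<beta>\<close> stands in for simplicity of \<open>\<beta>\<close>. Subtracting a multiple of \<open>g\<close> from its
  spheroidal image gives an eigenvector \<open>h\<close> for \<open>\<beta>\<close> with boundary value \<open>0\<close>. If \<open>h\<close> were nonzero, its
  dilation would be an eigenvector for \<open>-\<beta>\<close>, hence some eigenvector for \<open>-\<beta>\<close> would have a nonzero
  boundary value, and so does \<open>g\<close>, which two opposite eigenvalues do not permit. Hence \<open>g\<close> solves the
  spheroidal equation and cannot vanish at \<open>0\<close>.
\<close>
lemma eigvec_head_nonzero:
  assumes g: "eigvec \<beta> g" "\<beta> \<noteq> 0" "(\<Sum>m. g m) \<noteq> 0"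
    and opp: "\<And>f. eigvec (- \<beta>) f \<Longrightarrow> \<exists>m. f m \<noteq> 0 \<Longrightarrow> \<exists>f'. eigvec (- \<beta>) f' \<and> (\<Sum>m. f' m) \<noteq> 0"
  shows "g 0 \<noteq> 0"
proof
  assume g0: "g 0 = 0"
  define \<gamma> where "\<gamma> = (\<Sum>m. spheroidal g m) / (\<Sum>m. g m)"
  define h where "h = (\<lambda>m. spheroidal g m - \<gamma> * g m)"
  have h: "eigvec \<beta> h" "(\<Sum>m. h m) = 0"
    using eigvec_diff_cmult[OF eigvec_spheroidal[OF g(1,2)] g(1), of \<gamma>] g(3)
    by (auto simp: h_def \<gamma>_def)
  have "h m = 0" for m
  proof (rule ccontr)
    assume "h m \<noteq> 0"
    moreover have "real m + (\<nu> + 1) / 2 > 0"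
      using nu_gt by (intro add_nonneg_pos) auto
    ultimately have "dilation h m \<noteq> 0"
      by (simp add: dilation_def)
    then obtain f' where "eigvec (- \<beta>) f'" "(\<Sum>m. f' m) \<noteq> 0"
      using opp[OF eigvec_dilation[OF h(1) g(2) h(2)]] by blast
    then show False using eigvec_opposite[OF g(1) _ g(2)] g(3) by fastforce
  qed
  then have "g m = 0" for m
    using spheroidal_eigvec_zero[of g \<gamma>] g0 by (simp add: h_def)
  then show False using g(3) by simp
qed

end

section \<open>Zernike expansions of monomials at the origin\<close>

lemma pochhammer_mono_base:
  fixes x y :: real
  assumes "0 < x" "x \<le> y"
  shows "0 < pochhammer x n" "pochhammer x n \<le> pochhammer y n"
proof -
  show *: "0 < pochhammer x n" by (rule pochhammer_pos) fact
  show "pochhammer x n \<le> pochhammer y n"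
  proof (induction n)
    case (Suc n)
    have "pochhammer x n * (x + real n) \<le> pochhammer y n * (y + real n)"
      using Suc assms pochhammer_pos[of x n] pochhammer_pos[of y n] by (intro mult_mono) auto
    then show ?case by (simp add: pochhammer_Suc)
  qed simp
qed

text \<open>
  The left side is \<open>\<integral> P\<^sub>i(x) x\<^sup>l x\<^sup>\<nu> dx\<close> for the shifted Jacobi polynomial \<open>P\<^sub>i\<close> underlying the radial
  Zernike polynomial, integrated term by term with Beta integrals. Over the common denominator it is a
  Vandermonde convolution; the result vanishes for \<open>l < i\<close>, which is the orthogonality of \<open>P\<^sub>i\<close> to lower
  degrees.
\<close>
lemma zernike_moment_sum:
  fixes \<nu> :: real
  assumes "\<nu> > -1"
  shows "(\<Sum>m=0..i. (-1) ^ m * ((real i + \<nu>) gchoose m) * real (i choose m) *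
            (fact m / pochhammer (real l + \<nu> + 1 + real (i - m)) (Suc m)))
         = fact i * real (l choose i) / pochhammer (real l + \<nu> + 1) (Suc i)"
proof -
  define y where "y = real l + \<nu> + 1"
  have y: "y > 0" using assms by (simp add: y_def)
  have Pi: "pochhammer y (Suc i) > 0" using y by (rule pochhammer_pos)
  have "(-1) ^ m * ((real i + \<nu>) gchoose m) * real (i choose m) * (fact m / pochhammer (y + real (i - m)) (Suc m))
      = (-1) ^ i * fact i / pochhammer y (Suc i) * (((real i + \<nu>) gchoose m) * ((- y) gchoose (i - m)))"
    if "m \<in> {0..i}" for m
  proof -
    have m: "m \<le> i" using that by simp
    have P: "pochhammer y (Suc i) = pochhammer y (i - m) * pochhammer (y + real (i - m)) (Suc m)"
      using pochhammer_product'[of y "i - m" "Suc m"] m by simp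
    have pos: "pochhammer (y + real (i - m)) (Suc m) > 0"
      using y by (intro pochhammer_pos) auto
    have G: "pochhammer y (i - m) = (-1) ^ (i - m) * fact (i - m) * ((- y) gchoose (i - m))"
      by (simp add: gbinomial_pochhammer flip: power_mult_distrib)
    have F: "fact m * fact (i - m) * real (i choose m) = fact i"
      using binomial_fact_lemma[OF m] by (metis (mono_tags, lifting) of_nat_fact of_nat_mult)
    have S: "(-1::real) ^ m * (-1) ^ (i - m) = (-1) ^ i"
      using m by (simp flip: power_add)
    have "1 / pochhammer (y + real (i - m)) (Suc m) = pochhammer y (i - m) / pochhammer y (Suc i)"
      using P pos pochhammer_pos[OF y, of "i - m"] by (simp add: field_simps)
    then have "fact m / pochhammer (y + real (i - m)) (Suc m) = fact m * (pochhammer y (i - m) / pochhammer y (Suc i))"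
      by (metis mult.right_neutral times_divide_eq_right)
    then have "(-1) ^ m * ((real i + \<nu>) gchoose m) * real (i choose m) * (fact m / pochhammer (y + real (i - m)) (Suc m))
      = ((-1) ^ m * (-1) ^ (i - m)) * (fact m * fact (i - m) * real (i choose m)) / pochhammer y (Suc i)
          * (((real i + \<nu>) gchoose m) * ((- y) gchoose (i - m)))"
      by (simp add: G mult_ac)
    then show ?thesis unfolding F S .
  qed
  then have "(\<Sum>m=0..i. (-1) ^ m * ((real i + \<nu>) gchoose m) * real (i choose m) *
            (fact m / pochhammer (y + real (i - m)) (Suc m)))
      = (-1) ^ i * fact i / pochhammer y (Suc i) *
          (\<Sum>m=0..i. ((real i + \<nu>) gchoose m) * ((- y) gchoose (i - m)))"
    by (simp add: sum_distrib_left)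
  also have "(\<Sum>m=0..i. ((real i + \<nu>) gchoose m) * ((- y) gchoose (i - m))) = (real i + \<nu> + - y) gchoose i"
    by (rule gbinomial_Vandermonde)
  also have "real i + \<nu> + - y = real i - real l - 1"
    by (simp add: y_def)
  also have "(-1) ^ i * fact i / pochhammer y (Suc i) * ((real i - real l - 1) gchoose i)
      = fact i * (real l gchoose i) / pochhammer y (Suc i)"
    by (subst (2) gbinomial_negated_upper) simp
  finally show ?thesis by (simp add: y_def binomial_gbinomial)
qed

text \<open>
  The value at \<open>x = 0\<close> of the \<open>n\<close>-th partial sum of the Zernike expansion of \<open>x\<^sup>l\<close>, in closed form.
  For \<open>l > 0\<close> it vanishes as soon as \<open>n \<ge> l\<close>, when the expansion of \<open>x\<^sup>l\<close> is complete.
\<close>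
definition zernike_partial_sum_at_0 :: "real \<Rightarrow> nat \<Rightarrow> nat \<Rightarrow> real" where
  "zernike_partial_sum_at_0 \<nu> n l =
     (if l = 0 then 1
      else (-1) ^ n * pochhammer (\<nu> + 1) (Suc n) * real ((l - 1) choose n) / pochhammer (real l + \<nu> + 1) (Suc n))"

text \<open>
  Consecutive closed forms differ by exactly one summand, by Pascal's rule and
  \<open>(l - 1 - n) (l-1 choose n) = (n + 1) (l-1 choose n+1)\<close>.
\<close>
lemma zernike_telescope:
  fixes \<nu> :: real
  assumes "\<nu> > -1"
  shows "(\<Sum>i\<le>n. (2 * real i + \<nu> + 1) * (-1) ^ i * ((real i + \<nu>) gchoose i) *
            (fact i * real (l choose i) / pochhammer (real l + \<nu> + 1) (Suc i)))
         = zernike_partial_sum_at_0 \<nu> n l"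
proof -
  have G: "((real i + \<nu>) gchoose i) * fact i = pochhammer (\<nu> + 1) i" for i
    by (simp add: gbinomial_pochhammer' algebra_simps)
  have t: "(2 * real i + \<nu> + 1) * (-1) ^ i * ((real i + \<nu>) gchoose i) *
            (fact i * real (l choose i) / pochhammer (real l + \<nu> + 1) (Suc i))
      = (2 * real i + \<nu> + 1) * (-1) ^ i * pochhammer (\<nu> + 1) i * real (l choose i)
          / pochhammer (real l + \<nu> + 1) (Suc i)" for i
    by (simp flip: G)
  show ?thesis unfolding t
  proof (cases l)
    case 0
    have "(\<Sum>i\<le>n. (2 * real i + \<nu> + 1) * (-1) ^ i * pochhammer (\<nu> + 1) i * real (l choose i)
          / pochhammer (real l + \<nu> + 1) (Suc i)) = (\<Sum>i\<in>{0}. (2 * real i + \<nu> + 1) * (-1) ^ i * pochhammer (\<nu> + 1) i * real (l choose i)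
          / pochhammer (real l + \<nu> + 1) (Suc i))"
      by (rule sum.mono_neutral_right) (auto simp: 0)
    also have "\<dots> = 1" using assms by (simp add: 0)
    finally show "(\<Sum>i\<le>n. (2 * real i + \<nu> + 1) * (-1) ^ i * pochhammer (\<nu> + 1) i * real (l choose i)
          / pochhammer (real l + \<nu> + 1) (Suc i)) = zernike_partial_sum_at_0 \<nu> n l"
      by (simp add: zernike_partial_sum_at_0_def 0)
  next
    case (Suc j)
    show "(\<Sum>i\<le>n. (2 * real i + \<nu> + 1) * (-1) ^ i * pochhammer (\<nu> + 1) i * real (l choose i)
          / pochhammer (real l + \<nu> + 1) (Suc i)) = zernike_partial_sum_at_0 \<nu> n l"
    proof (induction n)
      case 0
      then show ?case by (simp add: zernike_partial_sum_at_0_def Suc)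
    next
      case (Suc n)
      define P where "P = pochhammer (\<nu> + 1) (Suc n)"
      define Q where "Q = pochhammer (real l + \<nu> + 1) (Suc n)"
      define q where "q = real l + \<nu> + 1 + real (Suc n)"
      define b where "b = real (j choose n)"
      define b' where "b' = real (j choose Suc n)"
      have l: "l = Suc j" by fact
      have Q: "Q > 0" "q > 0" unfolding Q_def q_def using assms by (auto intro!: pochhammer_pos)
      have P': "pochhammer (\<nu> + 1) (Suc (Suc n)) = (\<nu> + 1 + real (Suc n)) * P"
        and Q': "pochhammer (real l + \<nu> + 1) (Suc (Suc n)) = q * Q"
        unfolding P_def Q_def q_def by (simp_all only: pochhammer_rec'[of _ "Suc n"])
      have rel: "real j * b = real n * b + (real n + 1) * b'"
        using gbinomial_mult_1[of "real j" n] by (simp add: b_def b'_def binomial_gbinomial)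
      have "(2 * real (Suc n) + \<nu> + 1) * (b + b') = (\<nu> + 1 + real (Suc n)) * b' + q * b"
        using rel by (simp add: q_def l algebra_simps)
      then have "(-1) ^ n * P * b / Q + (-1) ^ Suc n * P * ((2 * real (Suc n) + \<nu> + 1) * (b + b')) / (q * Q)
          = (-1) ^ n * P * b / Q + (-1) ^ Suc n * P * ((\<nu> + 1 + real (Suc n)) * b' + q * b) / (q * Q)"
        by (simp only:)
      also have "\<dots> = (-1) ^ Suc n * ((\<nu> + 1 + real (Suc n)) * P) * b' / (q * Q)"
        using Q by (simp add: field_simps)
      also have "\<dots> = zernike_partial_sum_at_0 \<nu> (Suc n) l"
        unfolding zernike_partial_sum_at_0_def P' Q' by (simp add: l b'_def)
      also have "(-1) ^ n * P * b / Q = zernike_partial_sum_at_0 \<nu> n l"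
        unfolding zernike_partial_sum_at_0_def P_def Q_def by (simp add: l b_def)
      also have "(-1) ^ Suc n * P * ((2 * real (Suc n) + \<nu> + 1) * (b + b')) / (q * Q)
          = (2 * real (Suc n) + \<nu> + 1) * (-1) ^ Suc n * pochhammer (\<nu> + 1) (Suc n) * real (l choose Suc n)
              / pochhammer (real l + \<nu> + 1) (Suc (Suc n))"
        unfolding Q' P_def[symmetric] by (simp add: l b_def b'_def mult_ac)
      finally show ?case
        unfolding sum.atMost_Suc Suc.IH .
    qed
  qed
qed

lemma zernike_partial_sum_at_0_limit: "(\<lambda>n. zernike_partial_sum_at_0 \<nu> n l) \<longlonglongrightarrow> (if l = 0 then 1 else 0)"
proof (rule tendsto_eventually)
  show "eventually (\<lambda>n. zernike_partial_sum_at_0 \<nu> n l = (if l = 0 then 1 else 0)) sequentially"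
    using eventually_ge_at_top[of l] by eventually_elim (auto simp: zernike_partial_sum_at_0_def)
qed

text \<open>
  The quotient of Pochhammer symbols is at most \<open>1\<close>, so only the binomial coefficient grows. This
  growth in \<open>l\<close>, uniform in \<open>n\<close>, is dominated by the decay of entire coefficients.
\<close>
lemma zernike_partial_sum_at_0_bound:
  assumes "\<nu> > -1"
  shows "\<bar>zernike_partial_sum_at_0 \<nu> n l\<bar> \<le> 2 ^ l"
proof (cases "l = 0")
  case False
  define P where "P = pochhammer (\<nu> + 1) (Suc n)"
  define Q where "Q = pochhammer (real l + \<nu> + 1) (Suc n)"
  have PQ: "0 < P" "P \<le> Q"
    unfolding P_def Q_def using assms by (auto intro!: pochhammer_mono_base simp del: pochhammer_Suc)
  have "real ((l - 1) choose n) \<le> real (2 ^ (l - 1))"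
    by (rule of_nat_mono, rule binomial_le_pow2)
  also have "\<dots> \<le> 2 ^ l" by (simp add: power_increasing)
  finally have c: "real ((l - 1) choose n) \<le> 2 ^ l" .
  have "\<bar>zernike_partial_sum_at_0 \<nu> n l\<bar> = P / Q * real ((l - 1) choose n)"
    using PQ False by (simp add: zernike_partial_sum_at_0_def P_def[symmetric] Q_def[symmetric] abs_mult del: pochhammer_Suc)
  also have "\<dots> \<le> 1 * 2 ^ l"
    using PQ by (intro mult_mono c) auto
  finally show ?thesis by simp
qed (simp add: zernike_partial_sum_at_0_def)

text \<open>
  Convergence in \<open>L\<^sup>2\<close> says nothing about a single point; for an entire function, dominated
  convergence in the Taylor index gives it.
\<close>
lemma zernike_partial_sum_at_0_reproduces:
  assumes "entire_coeffs g" "\<nu> > -1"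
  shows "(\<lambda>n. \<Sum>l. g l * zernike_partial_sum_at_0 \<nu> n l) \<longlonglongrightarrow> g 0"
proof -
  have "(\<lambda>n. \<Sum>l. g l * zernike_partial_sum_at_0 \<nu> n l) \<longlonglongrightarrow> (\<Sum>l. g l * (if l = 0 then 1 else 0))"
  proof (rule conjunct2[OF conjunct2[OF tannerys_theorem]])
    show "((\<lambda>n. g l * zernike_partial_sum_at_0 \<nu> n l) \<longlongrightarrow> g l * (if l = 0 then 1 else 0)) sequentially" for l
      by (intro tendsto_mult tendsto_const zernike_partial_sum_at_0_limit)
    show "\<forall>\<^sub>F (l, n) in at_top \<times>\<^sub>F sequentially. norm (g l * zernike_partial_sum_at_0 \<nu> n l) \<le> \<bar>g l\<bar> * 2 ^ l"
      using zernike_partial_sum_at_0_bound[OF assms(2)] by (intro always_eventually) (auto simp: abs_mult mult_left_mono)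
    show "summable (\<lambda>l. \<bar>g l\<bar> * 2 ^ l)"
      by (rule entire_coeffs_summable) fact
  qed auto
  also have "(\<Sum>l. g l * (if l = 0 then 1 else 0)) = g 0"
    by (subst suminf_finite[of "{0}"]) auto
  finally show ?thesis .
qed

section \<open>Integration against the radial measure\<close>

lemma space_radial_measure [simp]: "space (radial_measure p) = {0..1}"
  by (simp add: radial_measure_def)

lemma sets_radial_measure [measurable_cong]: "sets (radial_measure p) = sets (lebesgue_on {0..1})"
  by (simp add: radial_measure_def)

lemma continuous_on_radial_weight:
  assumes "p \<ge> -1"
  shows "continuous_on {0..1} (\<lambda>\<rho>::real. \<rho> powi (p + 1))"
  using assms by (simp add: power_int_def continuous_intros)

lemma measurable_radial_weight:
  assumes "p \<ge> -1"
  shows "(\<lambda>\<rho>::real. \<rho> powi (p + 1)) \<in> borel_measurable (lebesgue_on {0..1})"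
  by (intro continuous_imp_measurable_on_sets_lebesgue continuous_on_radial_weight assms) auto

lemma measurable_radial_continuous:
  fixes f :: "real \<Rightarrow> real"
  assumes "continuous_on {0..1} f"
  shows "f \<in> borel_measurable (radial_measure p)"
  unfolding measurable_cong_sets[OF sets_radial_measure refl]
  by (intro continuous_imp_measurable_on_sets_lebesgue assms) auto

lemma integral_radial_measure:
  assumes "p \<ge> -1" "f \<in> borel_measurable (radial_measure p)"
  shows "(\<integral>r. f r \<partial>radial_measure p) = (\<integral>r. r powi (p + 1) * f r \<partial>lebesgue_on {0..1})"
proof -
  have "f \<in> borel_measurable (lebesgue_on {0..1})"
    using assms(2) unfolding measurable_cong_sets[OF sets_radial_measure refl] .
  moreover have "AE r in lebesgue_on {0..1}. 0 \<le> (r::real) powi (p + 1)"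
    by (intro AE_I2) auto
  ultimately show ?thesis
    unfolding radial_measure_def using measurable_radial_weight[OF assms(1)]
    by (subst integral_density) auto
qed

lemma integrable_radial_continuous:
  fixes f :: "real \<Rightarrow> real"
  assumes "p \<ge> -1" "continuous_on {0..1} f"
  shows "integrable (radial_measure p) f"
proof -
  have "integrable (lebesgue_on {0..1}) (\<lambda>r. r powi (p + 1) * f r)"
    by (intro continuous_imp_integrable_real continuous_on_mult continuous_on_radial_weight assms)
  moreover have "f \<in> borel_measurable (lebesgue_on {0..1})"
    by (intro continuous_imp_measurable_on_sets_lebesgue assms) auto
  moreover have "AE r in lebesgue_on {0..1}. 0 \<le> (r::real) powi (p + 1)"
    by (intro AE_I2) auto
  ultimately show ?thesis
    unfolding radial_measure_def using measurable_radial_weight[OF assms(1)]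
    by (subst integrable_density) auto
qed

lemma finite_measure_radial:
  assumes "p \<ge> -1"
  shows "finite_measure (radial_measure p)"
  using integrable_radial_continuous[OF assms, of "\<lambda>_. 1"]
  by (intro finite_measureI) (simp add: integrable_iff_bounded less_top)

lemma radial_L2_integrable:
  assumes "p \<ge> -1" "f \<in> radial_L2 p"
  shows "integrable (radial_measure p) f"
  using assms finite_measure.square_integrable_imp_integrable[OF finite_measure_radial]
  by (auto simp: radial_L2_def)

lemma continuous_radial_L2:
  assumes "p \<ge> -1" "continuous_on {0..1} f"
  shows "f \<in> radial_L2 p"
  using assms by (auto simp: radial_L2_def intro!: measurable_radial_continuous integrable_radial_continuous continuous_intros)

lemma integral_radial_power:
  assumes "p \<ge> -1"
  shows "(\<integral>r. r ^ j \<partial>radial_measure p) = 1 / (real j + of_int p + 2)"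
proof -
  define n where "n = j + nat (p + 1)"
  have "(\<integral>r. r ^ j \<partial>radial_measure p) = (\<integral>r. r powi (p + 1) * r ^ j \<partial>lebesgue_on {0..1})"
    by (intro integral_radial_measure assms measurable_radial_continuous continuous_intros)
  also have "\<dots> = (\<integral>r. r ^ n \<partial>lebesgue_on {0..1})"
    using assms by (simp add: power_int_def n_def power_add mult.commute)
  also have "\<dots> = integral {0..1} (\<lambda>r. r ^ n)"
    by (intro lebesgue_integral_eq_integral continuous_imp_integrable_real continuous_intros) auto
  also have "\<dots> = 1 / real (Suc n)"
  proof (rule integral_unique)
    have "((\<lambda>r::real. r ^ n) has_integral (1 ^ Suc n / real (Suc n) - 0 ^ Suc n / real (Suc n))) {0..1}"
    proof (rule fundamental_theorem_of_calculus)
      fix x :: real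
      show "((\<lambda>r. r ^ Suc n / real (Suc n)) has_vector_derivative x ^ n) (at x within {0..1})"
        using DERIV_cdivide[OF DERIV_pow[of "Suc n" x "{0..1}"], of "real (Suc n)"]
        by (simp add: has_real_derivative_iff_has_vector_derivative del: of_nat_Suc power_Suc)
    qed simp
    then show "((\<lambda>r::real. r ^ n) has_integral 1 / real (Suc n)) {0..1}" by simp
  qed
  also have "real (Suc n) = real j + of_int p + 2"
    using assms by (simp add: n_def)
  finally show ?thesis .
qed

lemma integrable_radial_mult_power:
  assumes "integrable (radial_measure p) f"
  shows "integrable (radial_measure p) (\<lambda>r. f r * r ^ j)"
    and "\<bar>\<integral>r. f r * r ^ j \<partial>radial_measure p\<bar> \<le> (\<integral>r. \<bar>f r\<bar> \<partial>radial_measure p)"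
proof -
  have [measurable]: "f \<in> borel_measurable (radial_measure p)" using assms by auto
  have [measurable]: "(\<lambda>r. r ^ j) \<in> borel_measurable (radial_measure p)"
    by (intro measurable_radial_continuous continuous_intros)
  have le: "AE r in radial_measure p. norm (f r * r ^ j) \<le> norm (f r)"
    by (intro AE_I2) (auto simp: abs_mult power_le_one mult_left_le)
  show *: "integrable (radial_measure p) (\<lambda>r. f r * r ^ j)"
    by (rule Bochner_Integration.integrable_bound[OF assms _ le]) simp
  have "\<bar>\<integral>r. f r * r ^ j \<partial>radial_measure p\<bar> \<le> (\<integral>r. \<bar>f r * r ^ j\<bar> \<partial>radial_measure p)"
    by (rule integral_abs_bound)
  also have "\<dots> \<le> (\<integral>r. \<bar>f r\<bar> \<partial>radial_measure p)"
    using le by (intro integral_mono_AE integrable_abs * assms) auto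
  finally show "\<bar>\<integral>r. f r * r ^ j \<partial>radial_measure p\<bar> \<le> (\<integral>r. \<bar>f r\<bar> \<partial>radial_measure p)" .
qed

text \<open>
  Term-by-term integration against an integrable factor; it serves for the kernel of the operator,
  for the moments of eigenfunctions and for the Zernike coefficients alike.
\<close>
lemma radial_integral_power_series:
  assumes f: "integrable (radial_measure p) f" and b: "summable (\<lambda>l. \<bar>b l\<bar>)"
  shows "(\<lambda>l. b l * (\<integral>r. f r * r ^ (2 * l) \<partial>radial_measure p))
           sums (\<integral>r. f r * (\<Sum>l. b l * r ^ (2 * l)) \<partial>radial_measure p)"
proof -
  let ?M = "radial_measure p"
  define F where "F l r = b l * (f r * r ^ (2 * l))" for l r
  have int: "integrable ?M (F l)" for l
    unfolding F_def[abs_def] by (intro integrable_mult_right integrable_radial_mult_power f)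
  have abs_le: "\<bar>b l * r ^ (2 * l)\<bar> \<le> \<bar>b l\<bar>" if "r \<in> {0..1}" for r l
    using that by (simp add: abs_mult power_le_one mult_left_le)
  have sb: "summable (\<lambda>l. \<bar>b l * r ^ (2 * l)\<bar>)" if "r \<in> {0..1}" for r
    by (rule summable_comparison_test'[OF b, where N = 0]) (use abs_le[OF that] in auto)
  have ae: "AE r in ?M. summable (\<lambda>l. norm (F l r))"
  proof (rule AE_I2)
    fix r assume "r \<in> space ?M"
    then have "summable (\<lambda>l. \<bar>f r\<bar> * \<bar>b l * r ^ (2 * l)\<bar>)"
      by (intro summable_mult sb) simp
    then show "summable (\<lambda>l. norm (F l r))"
      by (simp add: F_def abs_mult mult_ac)
  qed
  have sm: "summable (\<lambda>l. \<integral>r. norm (F l r) \<partial>?M)"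
  proof (rule summable_comparison_test'[where N = 0])
    show "summable (\<lambda>l. \<bar>b l\<bar> * (\<integral>r. \<bar>f r\<bar> \<partial>?M))"
      using b by (rule summable_mult2)
    fix l
    have "(\<integral>r. norm (F l r) \<partial>?M) \<le> (\<integral>r. \<bar>b l\<bar> * \<bar>f r\<bar> \<partial>?M)"
    proof (intro integral_mono integrable_norm int integrable_mult_right integrable_abs f)
      fix r assume "r \<in> space ?M"
      then have "\<bar>f r\<bar> * \<bar>b l * r ^ (2 * l)\<bar> \<le> \<bar>f r\<bar> * \<bar>b l\<bar>"
        by (intro mult_left_mono abs_le) auto
      then show "norm (F l r) \<le> \<bar>b l\<bar> * \<bar>f r\<bar>"
        by (simp add: F_def abs_mult mult_ac)
    qed
    then show "norm (\<integral>r. norm (F l r) \<partial>?M) \<le> \<bar>b l\<bar> * (\<integral>r. \<bar>f r\<bar> \<partial>?M)"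
      by simp
  qed
  have "(\<lambda>l. integral\<^sup>L ?M (F l)) sums (\<integral>r. (\<Sum>l. F l r) \<partial>?M)"
    by (rule sums_integral[OF int ae sm])
  also have "(\<integral>r. (\<Sum>l. F l r) \<partial>?M) = (\<integral>r. f r * (\<Sum>l. b l * r ^ (2 * l)) \<partial>?M)"
  proof (rule Bochner_Integration.integral_cong[OF refl])
    fix r assume "r \<in> space ?M"
    then have "summable (\<lambda>l. b l * r ^ (2 * l))"
      using sb[of r] by (auto intro: summable_rabs_cancel)
    then show "(\<Sum>l. F l r) = f r * (\<Sum>l. b l * r ^ (2 * l))"
      by (simp add: F_def suminf_mult[symmetric] mult_ac)
  qed
  finally show ?thesis
    by (simp add: F_def[abs_def])
qed

definition radial_series :: "nat \<Rightarrow> (nat \<Rightarrow> real) \<Rightarrow> real \<Rightarrow> real" where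
  "radial_series N g r = r ^ N * (\<Sum>l. g l * r ^ (2 * l))"

lemma continuous_radial_series:
  assumes "entire_coeffs g"
  shows "isCont (\<lambda>r. \<Sum>l. g l * r ^ (2 * l)) x"
proof -
  have "isCont (\<lambda>y. \<Sum>l. g l * y ^ l) (x ^ 2)"
  proof (rule isCont_powser_converges_everywhere)
    fix y
    have "summable (\<lambda>l. \<bar>g l\<bar> * \<bar>y\<bar> ^ l)" by (rule entire_coeffs_summable[OF assms])
    then show "summable (\<lambda>l. g l * y ^ l)"
      by (intro summable_rabs_cancel[of "\<lambda>l. g l * y ^ l"]) (simp add: abs_mult power_abs)
  qed
  then have "isCont ((\<lambda>y. \<Sum>l. g l * y ^ l) \<circ> (\<lambda>r. r ^ 2)) x"
    by (intro continuous_at_compose) auto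
  then show ?thesis by (simp add: o_def power_mult)
qed

section \<open>The finite Hankel transform and its eigenfunctions\<close>

text \<open>
  Through the kernel coefficients this setting becomes an instance of the matrix problem above. The
  factor \<open>1/2\<close> in the instance comes from \<open>r\<^bsup>2N+p+1\<^esup> dr = 1/2 x\<^sup>\<nu> dx\<close>. A first, auxiliary instance with
  \<open>\<kappa> = 1\<close> provides the decay of the Bessel coefficients.
\<close>
locale finite_Hankel_transform =
  fixes p :: int and c :: real and N :: nat
  assumes p_ge: "p \<ge> -1" and c_pos: "c > 0"
begin

abbreviation nu :: real where "nu \<equiv> real N + of_int p / 2"

definition bessel_coeff :: "nat \<Rightarrow> real" where
  "bessel_coeff m = (-1) ^ m * rGamma (nu + real m + 1) / fact m"

definition kernel_coeff :: "nat \<Rightarrow> real" where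
  "kernel_coeff m = 2 powr (- nu) * c ^ N * (c / 2) ^ (2 * m) * bessel_coeff m"

lemma nu_ge: "nu \<ge> -1/2"
  using p_ge by linarith

lemma bessel_coeff_Suc: "(real m + 1) * (real m + nu + 1) * bessel_coeff (Suc m) = - bessel_coeff m"
proof -
  have "(real m + nu + 1) * rGamma (real m + nu + 1 + 1) = rGamma (real m + nu + 1)"
    by (rule rGamma_plus1)
  then show ?thesis
    by (simp add: bessel_coeff_def add_ac mult_ac)
qed

lemma bessel_coeff_0: "bessel_coeff 0 > 0"
  using nu_ge by (auto simp: bessel_coeff_def rGamma_inverse_Gamma)

sublocale bessel: scaled_Hilbert_matrix nu 1 bessel_coeff
  using nu_ge bessel_coeff_0 bessel_coeff_Suc by unfold_locales auto

sublocale scaled_Hilbert_matrix nu "(c / 2)\<^sup>2" "\<lambda>m. kernel_coeff m / 2"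
proof
  show "nu > -1" using nu_ge by linarith
  show "(c / 2)\<^sup>2 > 0" using c_pos by simp
  show "kernel_coeff 0 / 2 \<noteq> 0"
    using bessel_coeff_0 c_pos by (simp add: kernel_coeff_def)
  fix m
  define A where "A = 2 powr (- nu) * c ^ N * (c / 2) ^ (2 * m) * (c / 2)\<^sup>2 / 2"
  have S: "kernel_coeff (Suc m) / 2 = A * bessel_coeff (Suc m)"
    by (simp add: kernel_coeff_def A_def power_add power2_eq_square)
  have Z: "- (c / 2)\<^sup>2 * (kernel_coeff m / 2) = A * - bessel_coeff m"
    by (simp add: kernel_coeff_def A_def)
  show "(real m + 1) * (real m + nu + 1) * (kernel_coeff (Suc m) / 2) = - (c / 2)\<^sup>2 * (kernel_coeff m / 2)"
    unfolding S Z bessel_coeff_Suc[symmetric] by (simp only: mult_ac)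
qed

lemma entire_bessel_coeff: "entire_coeffs bessel_coeff"
  by (rule entire_coeffsI[OF bessel.a_bound])

lemma summable_kernel_coeff: "summable (\<lambda>m. \<bar>kernel_coeff m\<bar>)"
proof -
  have "entire_coeffs (\<lambda>m. kernel_coeff m / 2)"
    by (rule entire_coeffsI[OF a_bound])
  from entire_coeffs_summable_abs[OF entire_coeffs_cmult[OF this, of 2]] show ?thesis by simp
qed

lemma bessel_J_pos:
  assumes "t > 0"
  shows "bessel_J nu t / t powr (of_int p / 2) = 2 powr (- nu) * t ^ N * (\<Sum>m. bessel_coeff m * (t / 2) ^ (2 * m))"
proof -
  have "bessel_J nu t = (t / 2) powr nu * (\<Sum>m. bessel_coeff m * (t / 2) ^ (2 * m))"
    using assms by (simp add: bessel_J_def bessel_coeff_def)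
  moreover have "(t / 2) powr nu = 2 powr (- nu) * t ^ N * t powr (of_int p / 2)"
  proof -
    have "(t / 2) powr nu = t powr (real N + of_int p / 2) / 2 powr nu"
      by (rule powr_divide)
    also have "t powr (real N + of_int p / 2) = t ^ N * t powr (of_int p / 2)"
      using assms by (simp only: powr_add powr_realpow)
    finally show ?thesis
      by (simp only: powr_minus_divide) simp
  qed
  ultimately show ?thesis
    using assms by simp
qed

lemma isCont_kernel_series:
  "isCont (\<lambda>t. 2 powr (- nu) * t ^ N * (\<Sum>m. bessel_coeff m * (t / 2) ^ (2 * m))) t"
proof -
  have "isCont (\<lambda>t. \<Sum>m. bessel_coeff m * (t / 2) ^ (2 * m)) t"
    using continuous_at_compose[of t "\<lambda>t. t / 2" "\<lambda>r. \<Sum>m. bessel_coeff m * r ^ (2 * m)"]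
      continuous_radial_series[OF entire_bessel_coeff, of "t / 2"] by (simp add: o_def)
  then show ?thesis by (intro continuous_intros)
qed

text \<open>
  At \<open>0\<close> the kernel is a limit, which equals the value of the power series by continuity; elsewhere
  the powers of \<open>t\<close> cancel.
\<close>
lemma H_kernel_series:
  assumes "t \<ge> 0"
  shows "H_kernel p N t = 2 powr (- nu) * t ^ N * (\<Sum>m. bessel_coeff m * (t / 2) ^ (2 * m))"
    (is "_ = ?F t")
proof (cases "t = 0")
  case False
  then show ?thesis using bessel_J_pos[of t] assms by (simp add: H_kernel_def)
next
  case True
  have "(?F \<longlongrightarrow> ?F 0) (at_right 0)"
    using isCont_kernel_series[of 0] unfolding isCont_def by (rule tendsto_within_subset) simp
  moreover have "eventually (\<lambda>t. ?F t = bessel_J nu t / t powr (of_int p / 2)) (at_right 0)"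
    using eventually_at_right_less[of "0::real"] by eventually_elim (simp add: bessel_J_pos)
  ultimately have "((\<lambda>t. bessel_J nu t / t powr (of_int p / 2)) \<longlongrightarrow> ?F 0) (at_right 0)"
    by (rule Lim_transform_eventually)
  then have "Lim (at_right 0) (\<lambda>t. bessel_J nu t / t powr (of_int p / 2)) = ?F 0"
    by (intro tendsto_Lim) simp_all
  then show ?thesis
    unfolding True H_kernel_def by simp
qed

lemma summable_bessel_series: "summable (\<lambda>m. bessel_coeff m * x ^ (2 * m))"
  using entire_coeffs_summable[OF entire_bessel_coeff, of "x\<^sup>2"]
  by (intro summable_rabs_cancel[of "\<lambda>m. bessel_coeff m * x ^ (2 * m)"]) (simp add: abs_mult power_mult)

lemma H_kernel_product:
  assumes "r \<ge> 0" "\<rho> \<ge> 0"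
  shows "H_kernel p N (c * r * \<rho>) = r ^ N * (\<rho> ^ N * (\<Sum>m. kernel_coeff m * r ^ (2 * m) * \<rho> ^ (2 * m)))"
proof -
  have s: "summable (\<lambda>m. bessel_coeff m * (c * r * \<rho> / 2) ^ (2 * m))"
    by (rule summable_bessel_series)
  have "(\<Sum>m. kernel_coeff m * r ^ (2 * m) * \<rho> ^ (2 * m))
      = (\<Sum>m. 2 powr (- nu) * c ^ N * (bessel_coeff m * (c * r * \<rho> / 2) ^ (2 * m)))"
    by (intro suminf_cong) (simp add: kernel_coeff_def power_mult_distrib power_divide mult_ac)
  also have "\<dots> = 2 powr (- nu) * c ^ N * (\<Sum>m. bessel_coeff m * (c * r * \<rho> / 2) ^ (2 * m))"
    by (rule suminf_mult[OF s])
  finally show ?thesis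
    using assms c_pos by (simp add: H_kernel_series power_mult_distrib mult_ac)
qed

definition radial_moment :: "(real \<Rightarrow> real) \<Rightarrow> nat \<Rightarrow> real" where
  "radial_moment f m = (\<integral>r. r ^ N * f r * r ^ (2 * m) \<partial>radial_measure p)"

lemma H_op_series:
  assumes f: "integrable (radial_measure p) f" and r: "r \<in> {0..1}"
  shows "H_op p c N f r = radial_series N (\<lambda>m. kernel_coeff m * radial_moment f m) r"
proof -
  have f': "integrable (radial_measure p) (\<lambda>r. r ^ N * f r)"
    using integrable_radial_mult_power(1)[OF f, of N] by (simp add: mult.commute)
  have s: "summable (\<lambda>m. \<bar>kernel_coeff m * r ^ (2 * m)\<bar>)"
    by (rule summable_comparison_test'[OF summable_kernel_coeff, where N = 0])
       (use r in \<open>auto simp: abs_mult power_le_one mult_left_le\<close>)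
  have "H_op p c N f r = (\<integral>\<rho>. r ^ N * (\<rho> ^ N * f \<rho> * (\<Sum>m. kernel_coeff m * r ^ (2 * m) * \<rho> ^ (2 * m))) \<partial>radial_measure p)"
    unfolding H_op_def using r
    by (intro Bochner_Integration.integral_cong) (auto simp: H_kernel_product)
  also have "\<dots> = r ^ N * (\<Sum>m. kernel_coeff m * r ^ (2 * m) * radial_moment f m)"
    using radial_integral_power_series[OF f' s] by (simp add: radial_moment_def sums_iff)
  finally show ?thesis by (simp add: radial_series_def mult_ac)
qed

lemma continuous_on_radial_series:
  assumes "entire_coeffs g"
  shows "continuous_on S (radial_series N g)"
  unfolding radial_series_def[abs_def]
  by (intro continuous_on_mult continuous_intros continuous_at_imp_continuous_on ballI continuous_radial_series assms)

lemma integral_radial_series: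
  assumes "continuous_on {0..1} h" "summable (\<lambda>l. \<bar>g l\<bar>)"
  shows "(\<lambda>l. g l * (\<integral>r. h r * r ^ N * r ^ (2 * l) \<partial>radial_measure p))
           sums (\<integral>r. h r * radial_series N g r \<partial>radial_measure p)"
  using radial_integral_power_series[OF integrable_radial_continuous[OF p_ge] assms(2), of "\<lambda>r. h r * r ^ N"] assms(1)
  by (simp add: radial_series_def mult.assoc continuous_intros)

lemma radial_moment_radial_series:
  assumes "summable (\<lambda>l. \<bar>g l\<bar>)"
  shows "radial_moment (radial_series N g) m = moment g m / 2"
proof -
  have "radial_moment (radial_series N g) m = (\<integral>r. (r ^ N * r ^ (2 * m)) * radial_series N g r \<partial>radial_measure p)"
    by (simp add: radial_moment_def mult_ac)
  also have "\<dots> = (\<Sum>l. g l * (\<integral>r. (r ^ N * r ^ (2 * m)) * r ^ N * r ^ (2 * l) \<partial>radial_measure p))"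
    using integral_radial_series[OF _ assms, of "\<lambda>r. r ^ N * r ^ (2 * m)"]
    by (simp add: sums_iff continuous_intros)
  also have "\<dots> = (\<Sum>l. g l / (real m + real l + nu + 1) / 2)"
  proof (rule suminf_cong)
    fix l
    have "(\<integral>r. (r ^ N * r ^ (2 * m)) * r ^ N * r ^ (2 * l) \<partial>radial_measure p)
        = (\<integral>r. r ^ (N + 2 * m + N + 2 * l) \<partial>radial_measure p)"
      by (simp only: power_add)
    also have "\<dots> = 1 / (2 * (real m + real l + nu + 1))"
      by (simp add: integral_radial_power[OF p_ge] algebra_simps)
    finally show "g l * (\<integral>r. (r ^ N * r ^ (2 * m)) * r ^ N * r ^ (2 * l) \<partial>radial_measure p)
        = g l / (real m + real l + nu + 1) / 2"
      by simp
  qed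
  also have "\<dots> = moment g m / 2"
    unfolding moment_def by (rule suminf_divide[OF summable_moment(1)[OF assms]])
  finally show ?thesis .
qed

lemma summable_radial_series:
  fixes g :: "nat \<Rightarrow> real" and r :: real
  assumes "summable (\<lambda>l. \<bar>g l\<bar>)" "r \<in> {0..1}"
  shows "summable (\<lambda>l. g l * r ^ (2 * l))"
  by (rule summable_comparison_test'[OF assms(1), where N = 0])
     (use assms(2) in \<open>auto simp: abs_mult power_le_one mult_left_le\<close>)

lemma radial_series_cmult:
  assumes "summable (\<lambda>l. \<bar>g l\<bar>)" "r \<in> {0..1}"
  shows "radial_series N (\<lambda>l. b * g l) r = b * radial_series N g r"
  using suminf_mult[OF summable_radial_series[OF assms], of b] by (simp add: radial_series_def mult_ac)

text \<open>
  Since \<open>\<beta> \<noteq> 0\<close>, the eigenvalue equation writes \<open>f\<close> as an image of the operator, hence as a power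
  series times \<open>r\<^sup>N\<close>; inserting this series into the equation gives the matrix equation.
\<close>
lemma eigenfunction_imp_eigvec:
  assumes f: "f \<in> radial_L2 p" and \<beta>: "\<beta> \<noteq> 0"
    and eq: "\<And>r. r \<in> {0..1} \<Longrightarrow> H_op p c N f r = \<beta> * f r"
  obtains g where "eigvec \<beta> g" "\<And>r. r \<in> {0..1} \<Longrightarrow> f r = radial_series N g r"
proof
  define g where "g m = kernel_coeff m * radial_moment f m / \<beta>" for m
  note int = radial_L2_integrable[OF p_ge f]
  have fin: "integrable (radial_measure p) (\<lambda>r. r ^ N * f r)"
    using integrable_radial_mult_power(1)[OF int, of N] by (simp add: mult.commute)
  define K where "K = (\<integral>r. \<bar>r ^ N * f r\<bar> \<partial>radial_measure p)"
  have sg: "summable (\<lambda>m. \<bar>g m\<bar>)"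
  proof (rule summable_comparison_test'[where N = 0])
    show "summable (\<lambda>m. \<bar>kernel_coeff m\<bar> * K / \<bar>\<beta>\<bar>)"
      by (intro summable_divide summable_mult2 summable_kernel_coeff)
    fix m
    have "\<bar>radial_moment f m\<bar> \<le> K"
      unfolding radial_moment_def K_def by (rule integrable_radial_mult_power(2)[OF fin])
    then show "norm \<bar>g m\<bar> \<le> \<bar>kernel_coeff m\<bar> * K / \<bar>\<beta>\<bar>"
      by (simp add: g_def abs_mult divide_right_mono mult_left_mono)
  qed
  show rep: "f r = radial_series N g r" if "r \<in> {0..1}" for r
  proof -
    have "\<beta> * f r = radial_series N (\<lambda>m. \<beta> * g m) r"
      using eq[OF that] H_op_series[OF int that] \<beta> by (simp add: g_def)
    also have "\<dots> = \<beta> * radial_series N g r"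
      by (rule radial_series_cmult[OF sg that])
    finally show ?thesis using \<beta> by simp
  qed
  have "radial_moment f m = moment g m / 2" for m
  proof -
    have "radial_moment f m = radial_moment (radial_series N g) m"
      unfolding radial_moment_def by (intro Bochner_Integration.integral_cong) (auto simp: rep)
    then show ?thesis using radial_moment_radial_series[OF sg] by simp
  qed
  then show "eigvec \<beta> g"
    using sg \<beta> by (simp add: eigvec_def g_def)
qed

text \<open>
  If the function vanished almost everywhere, all its moments would vanish, and the eigenvalue
  equation recovers the coefficients from the moments.
\<close>
lemma eigvec_imp_eigenvalue:
  assumes g: "eigvec \<beta> g" and \<beta>: "\<beta> \<noteq> 0" and nz: "\<exists>m. g m \<noteq> 0"
  shows "H_eigenvalue p c N \<beta>"
  unfolding H_eigenvalue_def
proof (intro bexI conjI)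
  let ?f = "radial_series N g"
  note e = eigvec_entire[OF g \<beta>]
  note sg = entire_coeffs_summable_abs[OF e]
  have eq: "\<beta> * g m = kernel_coeff m * radial_moment ?f m" for m
    using g unfolding radial_moment_radial_series[OF sg] eigvec_def by simp
  have cont: "continuous_on {0..1} ?f"
    by (rule continuous_on_radial_series[OF e])
  show "?f \<in> radial_L2 p"
    by (rule continuous_radial_L2[OF p_ge cont])
  show "AE r in radial_measure p. H_op p c N ?f r = \<beta> * ?f r"
  proof (rule AE_I2)
    fix r assume "r \<in> space (radial_measure p)"
    then have r: "r \<in> {0..1}" by simp
    show "H_op p c N ?f r = \<beta> * ?f r"
      unfolding H_op_series[OF integrable_radial_continuous[OF p_ge cont] r] eq[symmetric]
      by (rule radial_series_cmult[OF sg r])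
  qed
  show "\<not> (AE r in radial_measure p. ?f r = 0)"
  proof
    assume ae: "AE r in radial_measure p. ?f r = 0"
    have "radial_moment ?f m = 0" for m
      unfolding radial_moment_def
      by (rule integral_eq_zero_AE) (use ae in eventually_elim, simp)
    then have "\<beta> * g m = 0" for m using eq[of m] by simp
    then show False using nz \<beta> by simp
  qed
qed

text \<open>
  The normalization \<open>\<Phi> n 1 > 0\<close> says that every eigenvalue has an eigenvector with nonzero boundary
  value. Applied to an index with eigenvalue \<open>-\<beta> k\<close>, should there be one, this is the hypothesis of the
  lemma on the leading coefficient.
\<close>
lemma eigensystem_expansion:
  assumes "H_eigensystem p c N \<beta> \<Phi>"
  obtains g where "eigvec (\<beta> k) g" "\<And>r. r \<in> {0..1} \<Longrightarrow> \<Phi> k r = radial_series N g r" "g 0 \<noteq> 0"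
proof -
  have nz: "\<beta> n \<noteq> 0" and range: "range \<beta> = {\<mu>. H_eigenvalue p c N \<mu>}"
    and L2: "\<Phi> n \<in> radial_L2 p" and eq: "r \<in> {0..1} \<Longrightarrow> H_op p c N (\<Phi> n) r = \<beta> n * \<Phi> n r"
    and pos: "\<Phi> n 1 > 0" for n r
    using assms unfolding H_eigensystem_def by auto
  have expand: "\<exists>g. eigvec (\<beta> n) g \<and> (\<forall>r\<in>{0..1}. \<Phi> n r = radial_series N g r) \<and> (\<Sum>l. g l) \<noteq> 0" for n
  proof -
    obtain g where g: "eigvec (\<beta> n) g" "\<And>r. r \<in> {0..1} \<Longrightarrow> \<Phi> n r = radial_series N g r"
      using eigenfunction_imp_eigvec[OF L2 nz eq] by blast
    have "(\<Sum>l. g l) = \<Phi> n 1" using g(2)[of 1] by (simp add: radial_series_def)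
    then show ?thesis using g pos[of n] by force
  qed
  obtain g where g: "eigvec (\<beta> k) g" "\<forall>r\<in>{0..1}. \<Phi> k r = radial_series N g r" "(\<Sum>l. g l) \<noteq> 0"
    using expand by blast
  have "g 0 \<noteq> 0"
  proof (rule eigvec_head_nonzero[OF g(1) nz g(3)])
    fix f assume "eigvec (- \<beta> k) f" "\<exists>m. f m \<noteq> 0"
    then have "H_eigenvalue p c N (- \<beta> k)"
      using nz by (intro eigvec_imp_eigenvalue) auto
    then obtain j where "- \<beta> k = \<beta> j" using range by blast
    then show "\<exists>f'. eigvec (- \<beta> k) f' \<and> (\<Sum>m. f' m) \<noteq> 0"
      using expand[of j] by auto
  qed
  then show ?thesis using that g by blast
qed

section \<open>Behaviour at the origin and Zernike coefficients\<close>

lemma sqrt_powi: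
  assumes "s > 0"
  shows "sqrt s powi n = s powr (of_int n / 2)"
proof -
  have "sqrt s powi n = sqrt s powr of_int n"
    using assms by (simp add: powr_real_of_int')
  also have "\<dots> = s powr (of_int n / 2)"
    using assms by (simp add: powr_half_sqrt[symmetric] powr_powr)
  finally show ?thesis .
qed

lemma radial_series_limit:
  assumes "entire_coeffs g"
  shows "((\<lambda>r. \<Sum>l. g l * r ^ (2 * l)) \<longlongrightarrow> g 0) (at_right 0)"
proof -
  have "((\<lambda>r. \<Sum>l. g l * r ^ (2 * l)) \<longlongrightarrow> (\<Sum>l. g l * 0 ^ (2 * l))) (at_right 0)"
    using continuous_radial_series[OF assms, of 0] unfolding isCont_def by (rule tendsto_within_subset) simp
  also have "(\<Sum>l. g l * 0 ^ (2 * l)) = g 0"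
    by (subst suminf_finite[of "{0}"]) auto
  finally show ?thesis .
qed

lemma phi_tilde_at_0:
  assumes g: "entire_coeffs g" and f: "\<And>r. r \<in> {0..1} \<Longrightarrow> f r = radial_series N g r"
  shows "phi_tilde p N f 0 = g 0" "(phi_tilde p N f \<longlongrightarrow> g 0) (at_right 0)"
proof -
  let ?q = "\<lambda>s. phi_of p f s / s powr (real N + (of_int p + 1) / 2)"
  have small: "eventually (\<lambda>s. s \<in> {0<..<1}) (at_right (0::real))"
    by (rule eventually_at_right_real) simp
  have q: "?q s = (\<Sum>l. g l * s ^ (2 * l))" if "s \<in> {0<..<1}" for s
    using that f[of s]
    by (simp add: phi_of_def sqrt_powi radial_series_def powr_add powr_realpow)
  have q_lim: "(?q \<longlongrightarrow> g 0) (at_right 0)"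
    using radial_series_limit[OF g]
    by (rule Lim_transform_eventually) (use small in eventually_elim, simp add: q)
  then show "phi_tilde p N f 0 = g 0"
    unfolding phi_tilde_def by (simp add: tendsto_Lim)
  show "(phi_tilde p N f \<longlongrightarrow> g 0) (at_right 0)"
    using q_lim by (rule Lim_transform_eventually)
      (use small in eventually_elim, simp add: phi_tilde_def)
qed

text \<open>
  \<open>M\<close> is \<open>H\<close> conjugated by \<open>r\<^bsup>(p+1)/2\<^esup>\<close>, up to the factor \<open>c\<^bsup>(p+1)/2\<^esup>\<close>. The two integrands may
  differ at \<open>\<rho> = 0\<close> when \<open>p = -1\<close>, hence the exceptional null set.
\<close>
lemma M_op_eq_H_op:
  assumes f: "integrable (radial_measure p) f" and r: "0 < r"
  shows "M_op p c N (phi_of p f) r = (c * r) powr ((of_int p + 1) / 2) * H_op p c N f r"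
proof -
  let ?q = "(of_int p + 1) / 2 :: real"
  let ?F = "\<lambda>t. 2 powr (- nu) * t ^ N * (\<Sum>m. bessel_coeff m * (t / 2) ^ (2 * m))"
  have "continuous_on UNIV ?F"
    by (intro continuous_at_imp_continuous_on ballI isCont_kernel_series)
  then have "continuous_on {0..1} (\<lambda>\<rho>. ?F (c * r * \<rho>))"
    by (rule continuous_on_compose2) (auto intro!: continuous_intros)
  then have "continuous_on {0..1} (\<lambda>\<rho>. H_kernel p N (c * r * \<rho>))"
    using c_pos r by (subst continuous_on_cong[OF refl H_kernel_series]) auto
  then have meas: "(\<lambda>\<rho>. H_kernel p N (c * r * \<rho>) * f \<rho>) \<in> borel_measurable (radial_measure p)"
    by (intro borel_measurable_times measurable_radial_continuous borel_measurable_integrable[OF f])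
  have "H_op p c N f r = (\<integral>\<rho>. \<rho> powi (p + 1) * (H_kernel p N (c * r * \<rho>) * f \<rho>) \<partial>lebesgue_on {0..1})"
    unfolding H_op_def by (rule integral_radial_measure[OF p_ge meas])
  then have "(c * r) powr ?q * H_op p c N f r
      = (\<integral>\<rho>. (c * r) powr ?q * (\<rho> powi (p + 1) * (H_kernel p N (c * r * \<rho>) * f \<rho>)) \<partial>lebesgue_on {0..1})"
    by simp
  also have "\<dots> = M_op p c N (phi_of p f) r"
    unfolding M_op_def
  proof (rule integral_discrete_difference[where X = "{0}"])
    fix \<rho> :: real
    assume "\<rho> \<in> space (lebesgue_on {0..1})" "\<rho> \<notin> {0}"
    then have \<rho>: "\<rho> > 0" by auto
    define t where "t = c * r * \<rho>"
    have t: "t > 0" using c_pos r \<rho> by (simp add: t_def)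
    have J: "bessel_J nu t = H_kernel p N t * t powr (of_int p / 2)"
      using t by (simp add: H_kernel_def)
    have "t powr (of_int p / 2) * sqrt t = t powr ?q"
      using t by (simp add: powr_half_sqrt[symmetric] powr_add[symmetric] add_divide_distrib)
    also have "\<dots> = (c * r) powr ?q * \<rho> powr ?q"
      using c_pos r \<rho> by (simp add: t_def powr_mult)
    finally have T: "t powr (of_int p / 2) * sqrt t = (c * r) powr ?q * \<rho> powr ?q" .
    have W: "\<rho> powr ?q * sqrt \<rho> powi (p + 1) = \<rho> powi (p + 1)"
      using \<rho> sqrt_powi[of \<rho> "p + 1"] powr_real_of_int'[of \<rho> "p + 1"] by (simp add: powr_add[symmetric])
    have "bessel_J nu t * sqrt t * (sqrt \<rho> powi (p + 1) * f \<rho>)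
        = H_kernel p N t * (t powr (of_int p / 2) * sqrt t) * sqrt \<rho> powi (p + 1) * f \<rho>"
      by (simp add: J)
    also have "\<dots> = (c * r) powr ?q * (\<rho> powr ?q * sqrt \<rho> powi (p + 1)) * H_kernel p N t * f \<rho>"
      unfolding T by simp
    finally have "bessel_J nu t * sqrt t * (sqrt \<rho> powi (p + 1) * f \<rho>)
        = (c * r) powr ?q * (\<rho> powi (p + 1) * (H_kernel p N t * f \<rho>))"
      unfolding W by (simp only: mult.assoc)
    then show "(c * r) powr ?q * (\<rho> powi (p + 1) * (H_kernel p N (c * r * \<rho>) * f \<rho>))
        = bessel_J nu (c * r * \<rho>) * sqrt (c * r * \<rho>) * phi_of p f \<rho>"
      unfolding t_def phi_of_def by (rule sym)
  qed (auto simp: sets_restrict_space emeasure_restrict_space)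
  finally show ?thesis by simp
qed

text \<open>
  A Beta integral in \<open>x = r\<^sup>2\<close>. Multiplying by \<open>1 - r\<^sup>2\<close> is a difference in \<open>j\<close>, which gives it
  by induction without leaving integer powers of \<open>r\<close>.
\<close>
lemma integral_disc_polynomial:
  "(\<integral>r. r ^ (2 * N) * (r\<^sup>2) ^ j * (1 - r\<^sup>2) ^ m \<partial>radial_measure p)
     = fact m / pochhammer (real j + nu + 1) (Suc m) / 2"
proof (induction m arbitrary: j)
  case 0
  have "(\<integral>r. r ^ (2 * N) * (r\<^sup>2) ^ j * (1 - r\<^sup>2) ^ 0 \<partial>radial_measure p) = (\<integral>r. r ^ (2 * N + 2 * j) \<partial>radial_measure p)"
    by (simp add: power_add power_mult)
  also have "\<dots> = 1 / (2 * (real j + nu + 1))"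
    unfolding integral_radial_power[OF p_ge] by (simp add: algebra_simps)
  finally show ?case by simp
next
  case (Suc m)
  let ?x = "real j + nu + 1"
  let ?P = "pochhammer (?x + 1) m"
  have x: "?x > 0" "?x + real (Suc m) > 0" using nu_ge by auto
  have P: "?P > 0" using x by (intro pochhammer_pos) auto
  have int: "integrable (radial_measure p) (\<lambda>r. r ^ (2 * N) * (r\<^sup>2) ^ j * (1 - r\<^sup>2) ^ m)" for j
    by (intro integrable_radial_continuous[OF p_ge] continuous_intros)
  have "(\<integral>r. r ^ (2 * N) * (r\<^sup>2) ^ j * (1 - r\<^sup>2) ^ Suc m \<partial>radial_measure p)
      = (\<integral>r. r ^ (2 * N) * (r\<^sup>2) ^ j * (1 - r\<^sup>2) ^ m - r ^ (2 * N) * (r\<^sup>2) ^ Suc j * (1 - r\<^sup>2) ^ m \<partial>radial_measure p)"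
    by (simp add: algebra_simps)
  also have "\<dots> = fact m / pochhammer ?x (Suc m) / 2 - fact m / pochhammer (?x + 1) (Suc m) / 2"
    using Suc.IH[of j] Suc.IH[of "Suc j"] Bochner_Integration.integral_diff[OF int int, of j "Suc j"]
    by (simp only: of_nat_Suc add_ac)
  also have "pochhammer ?x (Suc m) = ?x * ?P"
    by (rule pochhammer_rec)
  also have "pochhammer (?x + 1) (Suc m) = (?x + real (Suc m)) * ?P"
    by (simp only: pochhammer_rec'[of "?x + 1" m] of_nat_Suc) simp
  also have "fact m / (?x * ?P) / 2 - fact m / ((?x + real (Suc m)) * ?P) / 2
      = fact (Suc m) / (?x * ((?x + real (Suc m)) * ?P)) / 2"
  proof -
    have "F / (x * P) / 2 - F / (y * P) / 2 = (y - x) * F / (x * (y * P)) / 2"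
      if "x > 0" "y > 0" "P > 0" for x y P F :: real
      using that by (simp add: field_simps)
    from this[OF x P, of "fact m"] show ?thesis by simp
  qed
  also have "?x * ((?x + real (Suc m)) * ?P) = pochhammer ?x (Suc (Suc m))"
    by (subst pochhammer_rec, subst pochhammer_rec'[of "?x + 1" m]) (simp add: algebra_simps)
  finally show ?case .
qed

lemma integral_zernike_power:
  "(\<integral>r. zernike_R p N i r * r ^ N * r ^ (2 * l) \<partial>radial_measure p)
     = fact i * real (l choose i) / pochhammer (real l + nu + 1) (Suc i) / 2"
proof -
  define C where "C m = (-1) ^ m * ((real i + nu) gchoose m) * real (i choose m)" for m
  have "(\<integral>r. zernike_R p N i r * r ^ N * r ^ (2 * l) \<partial>radial_measure p)
      = (\<integral>r. (\<Sum>m=0..i. C m * (r ^ (2 * N) * (r\<^sup>2) ^ (l + (i - m)) * (1 - r\<^sup>2) ^ m)) \<partial>radial_measure p)"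
  proof (rule Bochner_Integration.integral_cong[OF refl])
    fix r :: real
    have summand: "r ^ N * (K * (r\<^sup>2) ^ j * (1 - r\<^sup>2) ^ m) * r ^ N * r ^ (2 * l)
        = K * (r ^ (2 * N) * (r\<^sup>2) ^ (l + j) * (1 - r\<^sup>2) ^ m)" for K j m
      by (simp add: power_add power_mult power2_eq_square power_mult_distrib mult_ac)
    show "zernike_R p N i r * r ^ N * r ^ (2 * l)
        = (\<Sum>m=0..i. C m * (r ^ (2 * N) * (r\<^sup>2) ^ (l + (i - m)) * (1 - r\<^sup>2) ^ m))"
      unfolding zernike_R_def sum_distrib_left sum_distrib_right summand by (simp add: C_def add.assoc)
  qed
  also have "\<dots> = (\<Sum>m=0..i. C m * (\<integral>r. r ^ (2 * N) * (r\<^sup>2) ^ (l + (i - m)) * (1 - r\<^sup>2) ^ m \<partial>radial_measure p))"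
    by (subst Bochner_Integration.integral_sum)
       (auto intro!: integrable_mult_right integrable_radial_continuous[OF p_ge] continuous_intros)
  also have "\<dots> = (\<Sum>m=0..i. C m * (fact m / pochhammer (real l + nu + 1 + real (i - m)) (Suc m))) / 2"
    unfolding integral_disc_polynomial sum_divide_distrib
    by (intro sum.cong refl) (simp only: of_nat_add add_ac times_divide_eq_right)
  also have "(\<Sum>m=0..i. C m * (fact m / pochhammer (real l + nu + 1 + real (i - m)) (Suc m)))
      = fact i * real (l choose i) / pochhammer (real l + nu + 1) (Suc i)"
    unfolding C_def using nu_ge by (intro zernike_moment_sum) simp
  finally show ?thesis .
qed

lemma continuous_zernike_R: "continuous_on S (zernike_R p N i)"
  unfolding zernike_R_def[abs_def] by (intro continuous_intros)

lemma zernike_coeff_series: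
  assumes g: "entire_coeffs g" and f: "\<And>r. r \<in> {0..1} \<Longrightarrow> f r = radial_series N g r"
  shows "(\<lambda>l. g l * (fact i * real (l choose i) / pochhammer (real l + nu + 1) (Suc i)))
           sums (2 * zernike_coeff p N f i / sqrt (2 * (2 * real i + nu + 1)))"
proof -
  let ?s = "sqrt (2 * (2 * real i + nu + 1))"
  have s: "?s > 0" using nu_ge by simp
  have "zernike_coeff p N f i = (\<integral>r. ?s * (zernike_R p N i r * radial_series N g r) \<partial>radial_measure p)"
    unfolding zernike_coeff_def zernike_Rbar_def
    by (intro Bochner_Integration.integral_cong) (auto simp: f add_ac)
  then have "2 * zernike_coeff p N f i / ?s = 2 * (\<integral>r. zernike_R p N i r * radial_series N g r \<partial>radial_measure p)"
    using s by simp
  then show ?thesis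
    using sums_mult[OF integral_radial_series[OF continuous_zernike_R entire_coeffs_summable_abs[OF g], of i], of 2]
    unfolding integral_zernike_power by (simp add: mult.left_commute del: pochhammer_Suc)
qed

text \<open>
  At \<open>r = 0\<close> the polynomial \<open>R\<^sub>i(r) / r\<^sup>N\<close> takes the value \<open>(-1)\<^sup>i (i + \<nu> choose i)\<close>, so the series is
  the Zernike expansion of \<open>f(r) / r\<^sup>N\<close> evaluated at the origin.
\<close>
lemma zernike_expansion_at_0:
  assumes g: "entire_coeffs g" and f: "\<And>r. r \<in> {0..1} \<Longrightarrow> f r = radial_series N g r"
  shows "(\<lambda>i. zernike_coeff p N f i * sqrt (2 * (2 * real i + nu + 1)) * (-1) ^ i * ((real i + nu) gchoose i))
           sums g 0"
proof -
  define w where "w i = (2 * real i + nu + 1) * (-1) ^ i * ((real i + nu) gchoose i)" for i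
  define u where "u i l = fact i * real (l choose i) / pochhammer (real l + nu + 1) (Suc i)" for i l
  let ?t = "\<lambda>i. zernike_coeff p N f i * sqrt (2 * (2 * real i + nu + 1)) * (-1) ^ i * ((real i + nu) gchoose i)"
  have summand: "(\<lambda>l. g l * (w i * u i l)) sums ?t i" for i
  proof -
    define s where "s = sqrt (2 * (2 * real i + nu + 1))"
    have s: "s > 0" "s * s = 2 * (2 * real i + nu + 1)"
      using nu_ge by (auto simp: s_def)
    have "(\<lambda>l. w i * (g l * u i l)) sums (w i * (2 * zernike_coeff p N f i / s))"
      unfolding u_def s_def by (intro sums_mult zernike_coeff_series g f)
    also have "w i * (2 * zernike_coeff p N f i / s) = (s * s) * zernike_coeff p N f i / s * (-1) ^ i * ((real i + nu) gchoose i)"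
      unfolding s(2) w_def by simp
    also have "\<dots> = ?t i" unfolding s_def[symmetric] using s(1) by simp
    finally show ?thesis by (simp add: mult.left_commute)
  qed
  have "(\<Sum>i\<le>n. ?t i) = (\<Sum>l. g l * zernike_partial_sum_at_0 nu n l)" for n
  proof -
    have "(\<lambda>l. \<Sum>i\<le>n. g l * (w i * u i l)) sums (\<Sum>i\<le>n. ?t i)"
      by (intro sums_sum summand)
    moreover have "(\<Sum>i\<le>n. w i * u i l) = zernike_partial_sum_at_0 nu n l" for l
      unfolding w_def u_def using nu_ge by (intro zernike_telescope) simp
    ultimately show ?thesis
      by (simp add: sum_distrib_left[symmetric] sums_iff)
  qed
  moreover have "(\<lambda>n. \<Sum>l. g l * zernike_partial_sum_at_0 nu n l) \<longlonglongrightarrow> g 0"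
    using nu_ge by (intro zernike_partial_sum_at_0_reproduces g) simp
  ultimately show ?thesis unfolding sums_def_le by simp
qed

text \<open>
  The zeroth component of the matrix equation: as \<open>R\<^sub>0(r) = r\<^sup>N\<close>, the zeroth moment of an
  eigenfunction is its zeroth Zernike coefficient up to normalization.
\<close>
lemma eigenvalue_times_head:
  assumes g: "eigvec \<beta> g" and f: "\<And>r. r \<in> {0..1} \<Longrightarrow> f r = radial_series N g r"
  shows "\<beta> * g 0 = zernike_coeff p N f 0 * c ^ N
           * inverse (2 powr nu * Gamma (nu + 1) * sqrt (2 * real N + of_int p + 2))"
proof -
  define s where "s = sqrt (2 * real N + of_int p + 2)"
  have s: "s > 0" using p_ge by (simp add: s_def)
  have R0: "zernike_Rbar p N 0 r = s * r ^ N" for r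
    by (simp add: zernike_Rbar_def zernike_R_def s_def algebra_simps)
  have "zernike_coeff p N f 0 = (\<integral>r. s * (r ^ N * radial_series N g r * r ^ (2 * 0)) \<partial>radial_measure p)"
    unfolding zernike_coeff_def R0
    by (intro Bochner_Integration.integral_cong) (auto simp: f)
  also have "\<dots> = s * (moment g 0 / 2)"
    using g by (simp add: radial_moment_def[symmetric, of _ 0, simplified] radial_moment_radial_series eigvec_def)
  finally have "moment g 0 = 2 * zernike_coeff p N f 0 / s"
    using s by (simp add: field_simps)
  moreover have "\<beta> * g 0 = kernel_coeff 0 / 2 * moment g 0"
    using g unfolding eigvec_def by blast
  ultimately have "\<beta> * g 0 = kernel_coeff 0 * zernike_coeff p N f 0 / s"
    by simp
  also have "kernel_coeff 0 = c ^ N * inverse (2 powr nu * Gamma (nu + 1))"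
  proof -
    have "bessel_coeff 0 = inverse (Gamma (nu + 1))"
      by (simp add: bessel_coeff_def rGamma_inverse_Gamma)
    moreover have "2 powr (- nu) = inverse (2 powr nu)"
      by (rule powr_minus)
    moreover have "kernel_coeff 0 = 2 powr (- nu) * c ^ N * bessel_coeff 0"
      by (simp add: kernel_coeff_def)
    ultimately show ?thesis
      by (simp only: inverse_mult_distrib mult_ac)
  qed
  finally show ?thesis
    unfolding s_def by (simp only: divide_inverse inverse_mult_distrib mult_ac)
qed

end

section \<open>The eigenvalue formulas\<close>

theorem theorem4p4:
  fixes p :: int and c :: real and N k :: nat
    and \<beta> :: "nat \<Rightarrow> real" and \<Phi> :: "nat \<Rightarrow> real \<Rightarrow> real"
  assumes "p \<ge> -1" and "c > 0"
    and "H_eigensystem p c N \<beta> \<Phi>"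
  defines "\<nu> \<equiv> real N + of_int p / 2"
    and "q \<equiv> (of_int p + 1) / 2"
    and "a \<equiv> zernike_coeff p N (\<Phi> k)"
  shows
    "(phi_tilde p N (\<Phi> k) \<longlongrightarrow> phi_tilde p N (\<Phi> k) 0) (at_right 0) \<and>
     phi_tilde p N (\<Phi> k) 0 \<noteq> 0 \<and>
     (\<exists>L. ((\<lambda>r. r powr (- real N - q) * M_op p c N (phi_of p (\<Phi> k)) r) \<longlongrightarrow> L) (at_right 0) \<and>
          \<beta> k = c powr (- q) * (L / phi_tilde p N (\<Phi> k) 0)) \<and>
     (\<exists>S. (\<lambda>i. a i * sqrt (2 * (2 * real i + \<nu> + 1)) * (-1) ^ i * ((real i + \<nu>) gchoose i)) sums S \<and>
          S \<noteq> 0 \<and>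
          \<beta> k = a 0 * c ^ N * inverse (2 powr \<nu> * Gamma (\<nu> + 1) * sqrt (2 * real N + of_int p + 2)) / S)"
proof -
  interpret finite_Hankel_transform p c N
    by unfold_locales fact+
  obtain g where g: "eigvec (\<beta> k) g" "\<And>r. r \<in> {0..1} \<Longrightarrow> \<Phi> k r = radial_series N g r" "g 0 \<noteq> 0"
    using eigensystem_expansion[OF assms(3)] by blast
  have \<beta>: "\<beta> k \<noteq> 0" and L2: "\<Phi> k \<in> radial_L2 p"
    and eq: "\<And>r. r \<in> {0..1} \<Longrightarrow> H_op p c N (\<Phi> k) r = \<beta> k * \<Phi> k r"
    using assms(3) by (auto simp: H_eigensystem_def)
  note e = eigvec_entire[OF g(1) \<beta>]
  have tilde: "phi_tilde p N (\<Phi> k) 0 = g 0" "(phi_tilde p N (\<Phi> k) \<longlongrightarrow> g 0) (at_right 0)"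
    by (rule phi_tilde_at_0[OF e], erule g(2))+
  \<comment> \<open>Near \<open>0\<close>, \<open>M\<close> reproduces \<open>r\<^bsup>N+q\<^esup>\<close> times \<open>c\<^sup>q \<beta>\<close> times the power series of \<open>\<Phi> k\<close>.\<close>
  have lim: "((\<lambda>r. r powr (- real N - q) * M_op p c N (phi_of p (\<Phi> k)) r) \<longlongrightarrow> c powr q * \<beta> k * g 0) (at_right 0)"
  proof (rule Lim_transform_eventually)
    show "((\<lambda>r. c powr q * \<beta> k * (\<Sum>l. g l * r ^ (2 * l))) \<longlongrightarrow> c powr q * \<beta> k * g 0) (at_right 0)"
      by (intro tendsto_intros radial_series_limit e)
    have "eventually (\<lambda>s. s \<in> {0<..<1}) (at_right (0::real))"
      by (rule eventually_at_right_real) simp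
    then show "eventually (\<lambda>r. c powr q * \<beta> k * (\<Sum>l. g l * r ^ (2 * l))
        = r powr (- real N - q) * M_op p c N (phi_of p (\<Phi> k)) r) (at_right 0)"
    proof eventually_elim
      case (elim r)
      have "M_op p c N (phi_of p (\<Phi> k)) r = (c * r) powr q * (\<beta> k * radial_series N g r)"
        using M_op_eq_H_op[OF radial_L2_integrable[OF assms(1) L2], of r] eq[of r] g(2)[of r] elim
        by (simp add: q_def)
      also have "\<dots> = r powr q * r powr real N * (c powr q * \<beta> k * (\<Sum>l. g l * r ^ (2 * l)))"
        using elim assms(2) by (simp add: radial_series_def powr_mult powr_realpow)
      finally have "r powr (- real N - q) * M_op p c N (phi_of p (\<Phi> k)) r
         = r powr (- real N - q + q + real N) * (c powr q * \<beta> k * (\<Sum>l. g l * r ^ (2 * l)))"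
        by (simp only: powr_add mult.assoc)
      then show ?case using elim by simp
    qed
  qed
  have beta_lim: "\<beta> k = c powr (- q) * (c powr q * \<beta> k * g 0 / phi_tilde p N (\<Phi> k) 0)"
    unfolding tilde(1) using g(3) assms(2) by (simp add: powr_minus)
  have beta_sum: "\<beta> k = a 0 * c ^ N * inverse (2 powr \<nu> * Gamma (\<nu> + 1) * sqrt (2 * real N + of_int p + 2)) / g 0"
    unfolding a_def \<nu>_def using eigenvalue_times_head[OF g(1,2)] g(3) by (simp add: nonzero_eq_divide_eq)
  have sum: "(\<lambda>i. a i * sqrt (2 * (2 * real i + \<nu> + 1)) * (-1) ^ i * ((real i + \<nu>) gchoose i)) sums g 0"
    unfolding a_def \<nu>_def by (rule zernike_expansion_at_0[OF e g(2)])
  show ?thesis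
  proof (intro conjI)
    show "(phi_tilde p N (\<Phi> k) \<longlongrightarrow> phi_tilde p N (\<Phi> k) 0) (at_right 0)" "phi_tilde p N (\<Phi> k) 0 \<noteq> 0"
      using tilde g(3) by simp_all
    show "\<exists>L. ((\<lambda>r. r powr (- real N - q) * M_op p c N (phi_of p (\<Phi> k)) r) \<longlongrightarrow> L) (at_right 0) \<and>
        \<beta> k = c powr (- q) * (L / phi_tilde p N (\<Phi> k) 0)"
      by (intro exI[of _ "c powr q * \<beta> k * g 0"] conjI lim beta_lim)
    show "\<exists>S. (\<lambda>i. a i * sqrt (2 * (2 * real i + \<nu> + 1)) * (-1) ^ i * ((real i + \<nu>) gchoose i)) sums S \<and>
        S \<noteq> 0 \<and>
        \<beta> k = a 0 * c ^ N * inverse (2 powr \<nu> * Gamma (\<nu> + 1) * sqrt (2 * real N + of_int p + 2)) / S"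
      by (intro exI[of _ "g 0"] conjI sum g(3) beta_sum)
  qed
qed

end
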